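(* Let $X_1,\dots,X_n$ be independent with $\mathbb{E}(\psi_i(X_i)^2)<\infty$ for $1\le i\le n$, and let $\mathbf{X}^{(1)},\dots,\mathbf{X}^{(N)}$ be independent copies of $\mathbf{X}=(X_1,\dots,X_n)$. Then $$\mathbb{E}\bigl(N\cdot{}^N\!M_\rho^2(\mathbf{X}^{(1)},\dots,\mathbf{X}^{(N)})\bigr)=\frac{(N-1)^n+(-1)^n(N-1)}{N^n}\prod_{i=1}^n\mathbb{E}(\psi_i(X_i-X_i'))$$ $$=\prod_{i=1}^n\Bigl[\bigl(1-\tfrac1N\bigr)\mu_i^{(1)}\Bigr]+(N-1)\prod_{i=1}^n\Bigl[\bigl(-\tfrac1N\bigr)\mu_i^{(1)}\Bigr],$$ where $\mu_i^{(1)}=\mathbb{E}(\psi_i(X_i-X_i'))$, and $$\mathbb{E}\bigl([N\cdot{}^N\!M_\rho^2(\mathbf{X}^{(1)},\dots,\mathbf{X}^{(N)})]^2\bigr)=\frac1{N^2}\sum_{k=1}^7C(N,k)\prod_{i=1}^n\left[\frac{b(N,k)b_i+c(N,k)c_i+d(N,k)d_i}{N^4}\right],$$ where $b_i:=\mathbb{E}(\psi_i(X_i-X_i')^2)$, $c_i:=\mathbb{E}(\psi_i(X_i-X_i')\psi_i(X_i'-X_i''))$, $d_i:=[\mathbb{E}(\psi_i(X_i-X_i'))]^2$ and the coefficients $C(N,k),b(N,k),c(N,k),d(N,k)$ are the following: $k=1$: $C=N(N-1)(N-2)(N-3)$, $b=6N+2N^2$, $c=-24N-4N^2$, $d=18N+3N^2$;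 $k=2$: $C=2N(N-1)$, $b=6N-2N^2-2N^3+N^4$, $c=-24N+12N^2+4N^3-2N^4$, $d=18N-9N^2-2N^3+N^4$; $k=3$: $C=4N(N-1)(N-2)$, $b=6N-N^3$, $c=-24N+4N^2+2N^3$, $d=18N-3N^2-N^3$; $k=4$: $C=N(N-1)$, $b=6N-2N^2$, $c=-24N+12N^2$, $d=18N-9N^2-2N^3+N^4$; $k=5$: $C=4N(N-1)$, $b=6N-4N^2$, $c=-24N+20N^2-4N^3$, $d=18N-15N^2+3N^3$; $k=6$: $C=2N(N-1)(N-2)$, $b=6N$, $c=-24N+4N^2$, $d=18N-3N^2-N^3$; $k=7$: $C=N$, $b=6N-10N^2+4N^3$, $c=-24N+44N^2-24N^3+4N^4$, $d=18N-33N^2+18N^3-3N^4$.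
   Context: Each $X_i$ takes values in $\mathbb{R}^{d_i}$; $X_i',X_i''$ are independent copies of $X_i$. For each $i$, $\rho_i$ is a symmetric measure with full support on $\mathbb{R}^{d_i}$ with $\int 1\wedge|t_i|^2\,\rho_i(dt_i)<\infty$; $\rho=\bigotimes_{i=1}^n\rho_i$ and $\psi_i(x_i)=\int_{\mathbb{R}^{d_i}}1-\cos(x_i\cdot t_i)\,\rho_i(dt_i)$. Sample distance multivariance ${}^N\!M_\rho\ge 0$ is defined by ${}^N\!M_\rho^2(\mathbf{x}^{(1)},\dots,\mathbf{x}^{(N)})=\int|{}^N\!Z(t)|^2\,\rho(dt)$ with ${}^N\!Z(t)=\frac1N\sum_{l=1}^N\prod_{i=1}^n\bigl(e^{\mathrm{i}x_i^{(l)}\cdot t_i}-\frac1N\sum_{k=1}^Ne^{\mathrm{i}x_i^{(k)}\cdot t_i}\bigr)$; equivalently, $${}^N\!M_\rho^2(\mathbf{x}^{(1)},\dots,\mathbf{x}^{(N)})=\frac1{N^2}\sum_{j,k=1}^N\prod_{i=1}^n(A_i)_{j,k},\qquad A_i=-CB_iC,\quad C=I-\tfrac1N\mathbf{1},\quad B_i=\bigl(\psi_i(x_i^{(j)}-x_i^{(k)})\bigr)_{j,k=1,\dots,N},$$ where $I$ is the $N\times N$ identity matrix and $\mathbf{1}$ the $N\times N$ all-ones matrix. *)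

theory Defs
  imports "HOL-Probability.Probability"
begin

text \<open>Since the dimensions \<open>d i\<close> vary with \<open>i\<close>, a point of $\mathbb{R}^d$ is a function on \<open>{..<d}\<close>,
  extended by \<open>undefined\<close> outside, and \<open>Rd d\<close> carries the Borel sets of $\mathbb{R}^d$. As with
  \<open>borel\<close>, only the measurable space \<open>Rd d\<close> is relevant, not the measure attached to it.\<close>

definition Rd :: "nat \<Rightarrow> (nat \<Rightarrow> real) measure" where
  "Rd d = (\<Pi>\<^sub>M j\<in>{..<d}. borel)"

definition dot :: "nat \<Rightarrow> (nat \<Rightarrow> real) \<Rightarrow> (nat \<Rightarrow> real) \<Rightarrow> real" where
  "dot d x t = (\<Sum>j<d. x j * t j)"

definition vdiff :: "nat \<Rightarrow> (nat \<Rightarrow> real) \<Rightarrow> (nat \<Rightarrow> real) \<Rightarrow> nat \<Rightarrow> real" where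
  "vdiff d x y = (\<lambda>j\<in>{..<d}. x j - y j)"

definition symmetric_measure :: "nat \<Rightarrow> (nat \<Rightarrow> real) measure \<Rightarrow> bool" where
  "symmetric_measure d \<rho> \<longleftrightarrow> distr \<rho> (Rd d) (\<lambda>t. \<lambda>j\<in>{..<d}. - t j) = \<rho>"

definition full_support :: "nat \<Rightarrow> (nat \<Rightarrow> real) measure \<Rightarrow> bool" where
  "full_support d \<rho> \<longleftrightarrow>
     (\<forall>U. openin (product_topology (\<lambda>j. euclideanreal) {..<d}) U \<and> U \<noteq> {} \<longrightarrow> emeasure \<rho> U > 0)"

text \<open>\<open>L2_set t {..<d}\<close> is the Euclidean norm of \<open>t\<close>. A measure with these properties may still have
  infinite mass at the origin, where the integrand vanishes; \<open>\<sigma>\<close>-finiteness is not required.\<close>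

definition admissible_measure :: "nat \<Rightarrow> (nat \<Rightarrow> real) measure \<Rightarrow> bool" where
  "admissible_measure d \<rho> \<longleftrightarrow>
     sets \<rho> = sets (Rd d) \<and> symmetric_measure d \<rho> \<and> full_support d \<rho> \<and>
     (\<integral>\<^sup>+ t. ennreal (min 1 ((L2_set t {..<d})\<^sup>2)) \<partial>\<rho>) < \<infinity>"

definition psi :: "nat \<Rightarrow> (nat \<Rightarrow> real) measure \<Rightarrow> (nat \<Rightarrow> real) \<Rightarrow> real" where
  "psi d \<rho> x = (\<integral>t. 1 - cos (dot d x t) \<partial>\<rho>)"

text \<open>In a sample \<open>x\<close>, the vector \<open>x l i\<close> is the \<open>i\<close>-th component of the \<open>l\<close>-th observation.\<close>

definition sampleZ ::
  "nat \<Rightarrow> (nat \<Rightarrow> nat) \<Rightarrow> nat \<Rightarrow> (nat \<Rightarrow> nat \<Rightarrow> nat \<Rightarrow> real) \<Rightarrow> (nat \<Rightarrow> nat \<Rightarrow> real) \<Rightarrow> complex" where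
  "sampleZ n d N x t =
     1 / of_nat N * (\<Sum>l=1..N. \<Prod>i=1..n.
        exp (\<i> * complex_of_real (dot (d i) (x l i) (t i)))
        - 1 / of_nat N * (\<Sum>k=1..N. exp (\<i> * complex_of_real (dot (d i) (x k i) (t i)))))"

text \<open>If some \<open>\<rho> i\<close> has infinite mass at the origin, the product measure is determined only up to sets
  where some \<open>t i\<close> is zero. The integrand vanishes there, so the integral is unambiguous.\<close>

definition sample_multivariance ::
  "nat \<Rightarrow> (nat \<Rightarrow> nat) \<Rightarrow> (nat \<Rightarrow> (nat \<Rightarrow> real) measure) \<Rightarrow> nat
    \<Rightarrow> (nat \<Rightarrow> nat \<Rightarrow> nat \<Rightarrow> real) \<Rightarrow> real" where
  "sample_multivariance n d \<rho> N x =
     sqrt (\<integral>t. (cmod (sampleZ n d N x t))\<^sup>2 \<partial>(\<Pi>\<^sub>M i\<in>{1..n}. \<rho> i))"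

text \<open>The random variables \<open>Y k\<close>, \<open>k \<in> I\<close>, with values in \<open>S\<close>, are independent and distributed
  like \<open>Z\<close>; \<open>indep_vars\<close> includes their measurability.\<close>

definition indep_copies ::
  "'w measure \<Rightarrow> 'v measure \<Rightarrow> (nat \<Rightarrow> 'w \<Rightarrow> 'v) \<Rightarrow> nat set \<Rightarrow> ('w \<Rightarrow> 'v) \<Rightarrow> bool" where
  "indep_copies M S Y I Z \<longleftrightarrow>
     prob_space.indep_vars M (\<lambda>_. S) Y I \<and> (\<forall>k\<in>I. distr M S (Y k) = distr M S Z)"

text \<open>Coefficients \<open>(C, b, c, d)\<close> for \<open>k = 1, \<dots>, 7\<close>, in this order.\<close>

definition coeff_table :: "real \<Rightarrow> (real \<times> real \<times> real \<times> real) list" where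
  "coeff_table N =
    [(N * (N - 1) * (N - 2) * (N - 3),
      6*N + 2*N^2,
      - 24*N - 4*N^2,
      18*N + 3*N^2),
     (2 * N * (N - 1),
      6*N - 2*N^2 - 2*N^3 + N^4,
      - 24*N + 12*N^2 + 4*N^3 - 2*N^4,
      18*N - 9*N^2 - 2*N^3 + N^4),
     (4 * N * (N - 1) * (N - 2),
      6*N - N^3,
      - 24*N + 4*N^2 + 2*N^3,
      18*N - 3*N^2 - N^3),
     (N * (N - 1),
      6*N - 2*N^2,
      - 24*N + 12*N^2,
      18*N - 9*N^2 - 2*N^3 + N^4),
     (4 * N * (N - 1),
      6*N - 4*N^2,
      - 24*N + 20*N^2 - 4*N^3,
      18*N - 15*N^2 + 3*N^3),
     (2 * N * (N - 1) * (N - 2),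
      6*N,
      - 24*N + 4*N^2,
      18*N - 3*N^2 - N^3),
     (N,
      6*N - 10*N^2 + 4*N^3,
      - 24*N + 44*N^2 - 24*N^3 + 4*N^4,
      18*N - 33*N^2 + 18*N^3 - 3*N^4)]"

definition coeffC :: "nat \<Rightarrow> nat \<Rightarrow> real" where
  "coeffC N k = (case coeff_table (real N) ! (k - 1) of (C, b, c, d) \<Rightarrow> C)"

definition coeffb :: "nat \<Rightarrow> nat \<Rightarrow> real" where
  "coeffb N k = (case coeff_table (real N) ! (k - 1) of (C, b, c, d) \<Rightarrow> b)"

definition coeffc :: "nat \<Rightarrow> nat \<Rightarrow> real" where
  "coeffc N k = (case coeff_table (real N) ! (k - 1) of (C, b, c, d) \<Rightarrow> c)"

definition coeffd :: "nat \<Rightarrow> nat \<Rightarrow> real" where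
  "coeffd N k = (case coeff_table (real N) ! (k - 1) of (C, b, c, d) \<Rightarrow> d)"

end

theory Submission
  imports Defs
begin

text \<open>The integrand \<open>|Z(t)|\<^sup>2\<close> is a sum of products over \<open>i\<close>, so integrating it turns \<open>N M\<^sup>2\<close> into
  \<open>1/N \<Sum>\<^bsub>j,k\<^esub> \<Prod>\<^bsub>i\<^esub> (A\<^bsub>i\<^esub>)\<^bsub>j,k\<^esub>\<close> with \<open>A\<^bsub>i\<^esub> = - C B\<^bsub>i\<^esub> C\<close>; the imaginary parts cancel by symmetry of \<open>\<rho>\<^bsub>i\<^esub>\<close>.
  Independence of the coordinates moves the expectation inside the product, so only
  \<open>E A\<^bsub>j,k\<^esub>\<close> and \<open>E A\<^bsub>j,k\<^esub> A\<^bsub>l,m\<^esub>\<close> for one coordinate are needed. The moments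
  \<open>E \<psi>(X\<^bsub>p\<^esub> - X\<^bsub>q\<^esub>) \<psi>(X\<^bsub>r\<^esub> - X\<^bsub>s\<^esub>)\<close> are a polynomial in Kronecker deltas of \<open>p, q, r, s\<close>. Since the rows
  of \<open>C\<close> sum to zero, a monomial that leaves one of these indices free is annihilated by the centering,
  and with \<open>C\<^sup>2 = C\<close> and \<open>Q = \<Sum>\<^bsub>a\<^esub> C\<^bsub>j,a\<^esub> C\<^bsub>k,a\<^esub> C\<^bsub>l,a\<^esub> C\<^bsub>m,a\<^esub>\<close> there remains
  \<open>E A\<^bsub>j,k\<^esub> A\<^bsub>l,m\<^esub> = d C\<^bsub>j,k\<^esub> C\<^bsub>l,m\<^esub> + 4 (c - d) Q + (b - 2 c + d) (C\<^bsub>j,l\<^esub> C\<^bsub>k,m\<^esub> + C\<^bsub>j,m\<^esub> C\<^bsub>k,l\<^esub> - 2 Q)\<close>.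
  This depends only on which of \<open>j, k, l, m\<close> coincide, which gives the seven cases.\<close>

subsection \<open>Products of measures with an atom of infinite mass\<close>

text \<open>\<open>PiM\<close> is defined by extending a set function from cylinders. The extension
  takes the prescribed values as soon as some measure with these values on boxes exists, so a
  witness \<open>m\<close> suffices, whether or not the factors are sigma-finite.\<close>

lemma emeasure_PiM_extension:
  assumes I: "finite I" and A: "\<And>i. i \<in> I \<Longrightarrow> A i \<in> sets (M i)"
    and m: "positive (sets (PiM I M)) m" "countably_additive (sets (PiM I M)) m"
    and eq: "\<And>A. (\<And>i. i \<in> I \<Longrightarrow> A i \<in> sets (M i)) \<Longrightarrow> m (Pi\<^sub>E I A) = (\<Prod>i\<in>I. emeasure (M i) (A i))"
  shows "emeasure (PiM I M) (Pi\<^sub>E I A) = (\<Prod>i\<in>I. emeasure (M i) (A i))"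
proof -
  let ?I = "{i \<in> I. emeasure (M i) (space (M i)) \<noteq> 1}"
  have "emeasure (PiM I M) (prod_emb I M I (Pi\<^sub>E I A)) = (\<Prod>i\<in>I. emeasure (M i) (A i))"
  proof (subst emeasure_extend_measure_Pair[OF PiM_def, where \<mu>' = m])
    fix J E assume "(J \<noteq> {} \<or> I = {}) \<and> finite J \<and> J \<subseteq> I \<and> E \<in> (\<Pi> j\<in>J. sets (M j))"
    then have J: "finite J" "J \<subseteq> I" and E: "\<And>j. j \<in> J \<Longrightarrow> E j \<in> sets (M j)" by auto
    have emb: "prod_emb I M J (Pi\<^sub>E J E) = (\<Pi>\<^sub>E i\<in>I. if i \<in> J then E i else space (M i))"
      using J E by (intro prod_emb_PiE sets.sets_into_space) auto
    then have "m (prod_emb I M J (Pi\<^sub>E J E)) = (\<Prod>i\<in>I. emeasure (M i) (if i \<in> J then E i else space (M i)))"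
      using E by (auto simp: eq)
    \<comment> \<open>The definition of \<open>PiM\<close> multiplies over \<open>J\<close> and over
      the factors whose total mass is not 1. All other factors contribute 1.\<close>
    also have "\<dots> = (\<Prod>i\<in>J \<union> ?I. emeasure (M i) (if i \<in> J then E i else space (M i)))"
      using I J by (intro prod.mono_neutral_right) auto
    finally show "m (prod_emb I M J (Pi\<^sub>E J E)) =
        (\<Prod>i\<in>J \<union> ?I. if i \<in> J then emeasure (M i) (E i) else emeasure (M i) (space (M i)))"
      by (simp add: if_distrib cong: if_cong)
    show "prod_emb I M J (Pi\<^sub>E J E) \<in> Pow (\<Pi>\<^sub>E i\<in>I. space (M i))"
      using J E[THEN sets.sets_into_space] by (auto simp: prod_emb_iff PiE_def)
  qed (use I A m in \<open>auto intro!: prod.cong\<close>)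
  then show ?thesis
    using A by (subst (asm) prod_emb_PiE_same_index) (auto intro!: sets.sets_into_space)
qed

lemma borel_measurable_indicator_Compl_singleton:
  fixes M :: "'a measure"
  assumes "{p} \<in> sets M"
  shows "(indicator (- {p}) :: 'a \<Rightarrow> 'b::{zero_neq_one,t1_space}) \<in> borel_measurable M"
proof -
  have "- {p} \<inter> space M = space M - {p}" by auto
  then show ?thesis using assms by (simp add: borel_measurable_indicator_iff)
qed

lemma emeasure_density_Compl_singleton:
  assumes "{p} \<in> sets M" "A \<in> sets M"
  shows "emeasure (density M (indicator (- {p}))) A = emeasure M (A - {p})"
proof -
  have "emeasure (density M (indicator (- {p}))) A = (\<integral>\<^sup>+ x. indicator (- {p}) x * indicator A x \<partial>M)"
    using assms by (intro emeasure_density borel_measurable_indicator_Compl_singleton)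
  also have "\<dots> = (\<integral>\<^sup>+ x. indicator (A - {p}) x \<partial>M)"
    by (intro nn_integral_cong) (auto split: split_indicator)
  also have "\<dots> = emeasure M (A - {p})" using assms by (intro nn_integral_indicator) auto
  finally show ?thesis .
qed

text \<open>Writing \<open>M i\<close> as \<open>q i\<close> times the point mass at \<open>p i\<close> plus the rest, the product is expanded over
  the set \<open>S\<close> of those coordinates that use their point mass; the weights \<open>q i\<close> may be infinite.\<close>

lemma emeasure_PiM_atom:
  assumes I: "finite I" and A: "\<And>i. i \<in> I \<Longrightarrow> A i \<in> sets (M i)"
    and p: "\<And>i. i \<in> I \<Longrightarrow> {p i} \<in> sets (M i)"
    and fin: "\<And>i. i \<in> I \<Longrightarrow> sigma_finite_measure (density (M i) (indicator (- {p i})))"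
  shows "emeasure (PiM I M) (Pi\<^sub>E I A) = (\<Prod>i\<in>I. emeasure (M i) (A i))"
proof -
  \<comment> \<open>The weights are kept apart in \<open>c S\<close>, because an infinite weight on
    the point mass would destroy sigma-finiteness. Outside \<open>I\<close> the value
    \<open>count_space {}\<close> is a filler: \<open>product_sigma_finite\<close> speaks about
    every index.\<close>
  define Q where "Q S i = (if i \<notin> I then count_space {} else if i \<in> S then return (M i) (p i)
      else density (M i) (indicator (- {p i})))" for S i
  define c where "c S = (\<Prod>i\<in>S. emeasure (M i) {p i})" for S
  define m where "m B = (\<Sum>S\<in>Pow I. c S * emeasure (PiM I (Q S)) B)" for B
  have sQ: "sets (PiM I (Q S)) = sets (PiM I M)" for S
    by (intro sets_PiM_cong) (auto simp: Q_def)
  have pQ: "product_sigma_finite (Q S)" for S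
  proof (rule product_sigma_finite.intro)
    fix i
    have "sigma_finite_measure (return (M i) (p i))" if "i \<in> I"
      using p[OF that, THEN sets.sets_into_space]
      by (intro finite_measure.axioms(1) prob_space.finite_measure prob_space_return) auto
    then show "sigma_finite_measure (Q S i)"
      by (auto simp: Q_def fin intro: sigma_finite_measure_count_space_finite)
  qed
  show ?thesis
  proof (rule emeasure_PiM_extension[OF I A, where m = m])
    show "positive (sets (PiM I M)) m" by (simp add: positive_def m_def)
    show "countably_additive (sets (PiM I M)) m"
    proof (rule countably_additiveI)
      fix B :: "nat \<Rightarrow> _" assume B: "range B \<subseteq> sets (PiM I M)" "disjoint_family B"
      then have "(\<Sum>i. m (B i)) = (\<Sum>S\<in>Pow I. c S * (\<Sum>i. emeasure (PiM I (Q S)) (B i)))"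
        unfolding m_def by (subst suminf_sum) auto
      also have "\<dots> = m (\<Union>i. B i)"
        unfolding m_def using B by (intro sum.cong refl arg_cong2[where f = "(*)"] suminf_emeasure)
          (auto simp: sQ)
      finally show "(\<Sum>i. m (B i)) = m (\<Union>i. B i)" .
    qed
  next
    fix A assume A: "\<And>i. i \<in> I \<Longrightarrow> A i \<in> sets (M i)"
    have "m (Pi\<^sub>E I A) = (\<Sum>S\<in>Pow I. (\<Prod>i\<in>S. emeasure (M i) {p i} * indicator (A i) (p i))
        * (\<Prod>i\<in>I-S. emeasure (M i) (A i - {p i})))"
      unfolding m_def
    proof (intro sum.cong refl)
      fix S assume S: "S \<in> Pow I"
      interpret product_sigma_finite "Q S" by (rule pQ)
      have "emeasure (PiM I (Q S)) (Pi\<^sub>E I A) = (\<Prod>i\<in>I. emeasure (Q S i) (A i))"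
        using I A by (intro emeasure_PiM) (auto simp: Q_def)
      also have "\<dots> = (\<Prod>i\<in>I-S. emeasure (Q S i) (A i)) * (\<Prod>i\<in>S. emeasure (Q S i) (A i))"
        using I S by (intro prod.subset_diff) auto
      also have "(\<Prod>i\<in>I-S. emeasure (Q S i) (A i)) = (\<Prod>i\<in>I-S. emeasure (M i) (A i - {p i}))"
        by (intro prod.cong) (auto simp: Q_def A p emeasure_density_Compl_singleton)
      also have "(\<Prod>i\<in>S. emeasure (Q S i) (A i)) = (\<Prod>i\<in>S. indicator (A i) (p i))"
        using S A by (intro prod.cong) (auto simp: Q_def)
      finally show "c S * emeasure (PiM I (Q S)) (Pi\<^sub>E I A) =
          (\<Prod>i\<in>S. emeasure (M i) {p i} * indicator (A i) (p i)) * (\<Prod>i\<in>I-S. emeasure (M i) (A i - {p i}))"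
        by (simp add: c_def prod.distrib mult_ac)
    qed
    \<comment> \<open>Multiplying out this product of sums gives one term for each \<open>S\<close>.
      In each factor, the mass that \<open>A i\<close> has at \<open>p i\<close> and the mass of the
      rest add up to the mass of \<open>A i\<close>.\<close>
    also have "\<dots> = (\<Prod>i\<in>I. emeasure (M i) {p i} * indicator (A i) (p i) + emeasure (M i) (A i - {p i}))"
      using I by (rule prod_add[symmetric])
    also have "\<dots> = (\<Prod>i\<in>I. emeasure (M i) (A i))"
    proof (intro prod.cong refl)
      fix i assume i: "i \<in> I"
      show "emeasure (M i) {p i} * indicator (A i) (p i) + emeasure (M i) (A i - {p i}) = emeasure (M i) (A i)"
      proof (cases "p i \<in> A i")
        case True
        then have "emeasure (M i) {p i} + emeasure (M i) (A i - {p i}) = emeasure (M i) ({p i} \<union> (A i - {p i}))"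
          using p A i by (intro plus_emeasure) auto
        with True show ?thesis by (simp add: insert_absorb)
      qed simp
    qed
    finally show "m (Pi\<^sub>E I A) = (\<Prod>i\<in>I. emeasure (M i) (A i))" .
  qed
qed

text \<open>The product of the \<open>f i\<close> vanishes as soon as one \<open>x i\<close> equals
  \<open>p i\<close>. Removing these points by the density \<open>h\<close> therefore changes no
  integral, and it turns \<open>PiM I M\<close> into a product of sigma-finite measures, where
  Fubini's theorem applies.\<close>

lemma integral_PiM_prod_atom:
  fixes f :: "'i \<Rightarrow> 'a \<Rightarrow> complex"
  assumes I: "finite I"
    and p: "\<And>i. i \<in> I \<Longrightarrow> {p i} \<in> sets (M i)"
    and fin: "\<And>i. i \<in> I \<Longrightarrow> sigma_finite_measure (density (M i) (indicator (- {p i})))"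
    and f: "\<And>i. i \<in> I \<Longrightarrow> integrable (M i) (f i)"
    and f0: "\<And>i. i \<in> I \<Longrightarrow> f i (p i) = 0"
  shows "integrable (PiM I M) (\<lambda>x. \<Prod>i\<in>I. f i (x i))"
    and "(\<integral>x. (\<Prod>i\<in>I. f i (x i)) \<partial>PiM I M) = (\<Prod>i\<in>I. integral\<^sup>L (M i) (f i))"
proof -
  define D where "D i = (if i \<in> I then density (M i) (indicator (- {p i})) else count_space {})" for i
  define h :: "_ \<Rightarrow> real" where "h x = (\<Prod>i\<in>I. indicator (- {p i}) (x i))" for x
  interpret D: product_sigma_finite D
    by (rule product_sigma_finite.intro)
      (auto simp: D_def fin intro: sigma_finite_measure_count_space_finite)
  have sD: "sets (PiM I D) = sets (PiM I M)"
    by (intro sets_PiM_cong) (auto simp: D_def)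
  have h: "h \<in> borel_measurable (PiM I M)"
    unfolding h_def using p by (auto intro!: borel_measurable_prod measurable_compose[OF measurable_component_singleton])
  have "density (PiM I M) (\<lambda>x. ennreal (h x)) = PiM I D"
  proof (rule D.PiM_eqI[OF I])
    fix A assume "\<And>i. i \<in> I \<Longrightarrow> A i \<in> sets (D i)"
    then have A: "\<And>i. i \<in> I \<Longrightarrow> A i \<in> sets (M i)" by (simp add: D_def)
    have h_A: "h x * indicator (Pi\<^sub>E I A) x = indicator (\<Pi>\<^sub>E i\<in>I. A i - {p i}) x" for x
    proof (cases "\<exists>i\<in>I. x i = p i")
      case True
      then show ?thesis using I by (auto simp: h_def indicator_def PiE_iff)
    next
      case False
      then have "h x = 1" unfolding h_def by (intro prod.neutral) auto
      with False show ?thesis by (auto simp: indicator_def PiE_iff)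
    qed
    have "emeasure (density (PiM I M) (\<lambda>x. ennreal (h x))) (Pi\<^sub>E I A)
        = (\<integral>\<^sup>+ x. ennreal (h x) * indicator (Pi\<^sub>E I A) x \<partial>PiM I M)"
      using I A h by (intro emeasure_density) auto
    also have "\<dots> = (\<integral>\<^sup>+ x. ennreal (h x * indicator (Pi\<^sub>E I A) x) \<partial>PiM I M)"
      by (intro nn_integral_cong) (auto split: split_indicator)
    also have "\<dots> = (\<integral>\<^sup>+ x. indicator (\<Pi>\<^sub>E i\<in>I. A i - {p i}) x \<partial>PiM I M)"
      by (simp add: h_A ennreal_indicator)
    also have "\<dots> = (\<Prod>i\<in>I. emeasure (M i) (A i - {p i}))"
      using I A p by (subst nn_integral_indicator) (auto intro!: sets_PiM_I_finite emeasure_PiM_atom fin)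
    also have "\<dots> = (\<Prod>i\<in>I. emeasure (D i) (A i))"
      by (intro prod.cong) (auto simp: D_def A p emeasure_density_Compl_singleton)
    finally show "emeasure (density (PiM I M) (\<lambda>x. ennreal (h x))) (Pi\<^sub>E I A) = (\<Prod>i\<in>I. emeasure (D i) (A i))" .
  qed (simp add: sD)
  moreover have hf: "h x *\<^sub>R (\<Prod>i\<in>I. f i (x i)) = (\<Prod>i\<in>I. f i (x i))" for x
  proof (cases "\<exists>i\<in>I. x i = p i")
    case True
    then have "(\<Prod>i\<in>I. f i (x i)) = 0" using I f0 by (auto intro!: prod_zero) metis
    then show ?thesis by simp
  next
    case False
    then have "h x = 1" unfolding h_def by (intro prod.neutral) auto
    then show ?thesis by simp
  qed
  moreover have fm: "(\<lambda>x. \<Prod>i\<in>I. f i (x i)) \<in> borel_measurable (PiM I M)"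
    using f by (intro borel_measurable_prod measurable_compose[OF measurable_component_singleton]) auto
  moreover have h0: "AE x in PiM I M. 0 \<le> h x" by (auto simp: h_def intro!: prod_nonneg)
  ultimately have *: "integrable (PiM I D) (\<lambda>x. \<Prod>i\<in>I. f i (x i)) = integrable (PiM I M) (\<lambda>x. \<Prod>i\<in>I. f i (x i))"
    "(\<integral>x. (\<Prod>i\<in>I. f i (x i)) \<partial>PiM I D) = (\<integral>x. (\<Prod>i\<in>I. f i (x i)) \<partial>PiM I M)"
    using integrable_density[OF fm h h0] integral_density[OF fm h h0] by simp_all
  have Di: "integrable (D i) (f i)" "integral\<^sup>L (D i) (f i) = integral\<^sup>L (M i) (f i)" if i: "i \<in> I" for i
  proof -
    have D_eq: "D i = density (M i) (\<lambda>x. ennreal (indicator (- {p i}) x))" using i by (simp add: D_def ennreal_indicator)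
    have e: "indicator (- {p i}) x *\<^sub>R f i x = f i x" for x using f0[OF i] by (auto simp: indicator_def)
    show "integrable (D i) (f i)" "integral\<^sup>L (D i) (f i) = integral\<^sup>L (M i) (f i)"
      unfolding D_eq using f[OF i] p[OF i]
      by (subst integrable_density integral_density; simp add: e)+
  qed
  show "integrable (PiM I M) (\<lambda>x. \<Prod>i\<in>I. f i (x i))"
    using D.product_integrable_prod[OF I, of f] Di * by simp
  show "(\<integral>x. (\<Prod>i\<in>I. f i (x i)) \<partial>PiM I M) = (\<Prod>i\<in>I. integral\<^sup>L (M i) (f i))"
    using D.product_integral_prod[OF I, of f] Di * by simp
qed

subsection \<open>The functions \<open>\<psi>\<close>\<close>

lemma space_Rd: "space (Rd d) = {..<d} \<rightarrow>\<^sub>E UNIV"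
  by (simp add: Rd_def space_PiM)

lemma measurable_component_Rd [measurable]: "j < d \<Longrightarrow> (\<lambda>x. x j) \<in> borel_measurable (Rd d)"
  unfolding Rd_def by (rule measurable_component_singleton) simp

lemma measurable_dot_pair [measurable]: "(\<lambda>(x, t). dot d x t) \<in> borel_measurable (Rd d \<Otimes>\<^sub>M Rd d)"
  unfolding dot_def by (auto simp: case_prod_unfold)

lemma measurable_dot [measurable]: "dot d x \<in> borel_measurable (Rd d)"
  unfolding dot_def[abs_def] by measurable

lemma measurable_L2_set [measurable]: "(\<lambda>t. L2_set t {..<d}) \<in> borel_measurable (Rd d)"
  unfolding L2_set_def by measurable

lemma measurable_vdiff [measurable]: "(\<lambda>(x, y). vdiff d x y) \<in> Rd d \<Otimes>\<^sub>M Rd d \<rightarrow>\<^sub>M Rd d"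
proof -
  have "(\<lambda>z. \<lambda>j\<in>{..<d}. fst z j - snd z j) \<in> Rd d \<Otimes>\<^sub>M Rd d \<rightarrow>\<^sub>M Rd d"
    by (subst (3) Rd_def, rule measurable_restrict) measurable
  then show ?thesis by (simp add: vdiff_def case_prod_unfold)
qed

lemma dot_vdiff: "dot d (vdiff d x y) t = dot d x t - dot d y t"
  by (simp add: dot_def vdiff_def sum_subtractf left_diff_distrib)

lemma dot_uminus: "dot d x (\<lambda>j\<in>{..<d}. - t j) = - dot d x t"
  by (simp add: dot_def sum_negf)

definition origin :: "nat \<Rightarrow> nat \<Rightarrow> real" where
  "origin d = (\<lambda>j\<in>{..<d}. 0)"

lemma dot_origin [simp]: "dot d x (origin d) = 0"
  by (simp add: dot_def origin_def)

lemma sets_origin: "{origin d} \<in> sets (Rd d)"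
proof -
  have "{origin d} = (\<Pi>\<^sub>E j\<in>{..<d}. {0})" by (simp add: origin_def PiE_singleton)
  also have "\<dots> \<in> sets (Rd d)" unfolding Rd_def by (intro sets_PiM_I_finite) auto
  finally show ?thesis .
qed

lemma L2_set_eq_0_origin: "t \<in> space (Rd d) \<Longrightarrow> L2_set t {..<d} = 0 \<longleftrightarrow> t = origin d"
  by (auto simp: space_Rd origin_def PiE_iff fun_eq_iff extensional_def L2_set_def sum_nonneg_eq_0_iff)

locale admissible =
  fixes d :: nat and \<rho> :: "(nat \<Rightarrow> real) measure"
  assumes admissible: "admissible_measure d \<rho>"
begin

lemma sets_rho [measurable_cong]: "sets \<rho> = sets (Rd d)"
  and symmetric: "distr \<rho> (Rd d) (\<lambda>t. \<lambda>j\<in>{..<d}. - t j) = \<rho>"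
  and finite_min: "(\<integral>\<^sup>+ t. ennreal (min 1 ((L2_set t {..<d})\<^sup>2)) \<partial>\<rho>) < \<infinity>"
  using admissible by (auto simp: admissible_measure_def symmetric_measure_def)

lemma space_rho: "space \<rho> = space (Rd d)"
  by (rule sets_eq_imp_space_eq[OF sets_rho])

lemma sets_origin_rho: "{origin d} \<in> sets \<rho>"
  using sets_origin sets_rho by simp

text \<open>Weighting \<open>\<rho>\<close> with \<open>min 1 |t|^2\<close> gives a finite measure.
  A real-valued density over it is sigma-finite, and the reciprocal of the weight restores
  \<open>\<rho>\<close> wherever the weight is positive, that is, off the origin.\<close>

lemma sigma_finite_off_origin: "sigma_finite_measure (density \<rho> (indicator (- {origin d})))"
proof -
  define m where "m t = min 1 ((L2_set t {..<d})\<^sup>2)" for t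
  define \<nu> where "\<nu> = density \<rho> (\<lambda>t. ennreal (m t))"
  have m [measurable]: "m \<in> borel_measurable \<rho>" unfolding m_def by measurable
  have \<nu>: "finite_measure \<nu>"
  proof (rule finite_measureI)
    have "emeasure \<nu> (space \<nu>) = (\<integral>\<^sup>+ t. ennreal (m t) * indicator (space \<rho>) t \<partial>\<rho>)"
      unfolding \<nu>_def by (subst emeasure_density) auto
    also have "\<dots> = (\<integral>\<^sup>+ t. ennreal (m t) \<partial>\<rho>)" by (intro nn_integral_cong) auto
    finally show "emeasure \<nu> (space \<nu>) \<noteq> \<infinity>" using finite_min by (simp add: m_def)
  qed
  then interpret \<nu>: finite_measure \<nu> .
  have "sigma_finite_measure (density \<nu> (\<lambda>t. ennreal (1 / m t)))"
    by (subst \<nu>.sigma_finite_iff_density_finite) (auto simp: \<nu>_def)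
  also have "density \<nu> (\<lambda>t. ennreal (1 / m t)) = density \<rho> (\<lambda>t. ennreal (m t) * ennreal (1 / m t))"
    unfolding \<nu>_def by (rule density_density_eq) auto
  also have "\<dots> = density \<rho> (indicator (- {origin d}))"
  proof (rule density_cong)
    show "AE t in \<rho>. ennreal (m t) * ennreal (1 / m t) = indicator (- {origin d}) t"
    proof (rule AE_I2)
      fix t assume t: "t \<in> space \<rho>"
      have "0 \<le> m t" by (simp add: m_def)
      then have "ennreal (m t) * ennreal (1 / m t) = ennreal (m t * (1 / m t))" by (simp flip: ennreal_mult')
      then show "ennreal (m t) * ennreal (1 / m t) = indicator (- {origin d}) t"
        using L2_set_eq_0_origin[of t d] t space_rho by (auto simp: m_def min_def split: split_indicator)
    qed
  qed (use borel_measurable_indicator_Compl_singleton[OF sets_origin_rho] in auto)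
  finally show ?thesis .
qed

text \<open>Since \<open>1 - cos s\<close> is at most 2 and at most \<open>s^2\<close>, and
  \<open>|s| \<le> |x| |t|\<close> by Cauchy-Schwarz, the integrand is dominated by a multiple of
  \<open>min 1 |t|^2\<close>.\<close>

lemma integrable_one_minus_cos: "integrable \<rho> (\<lambda>t. 1 - cos (dot d x t))"
proof (rule Bochner_Integration.integrable_bound)
  let ?C = "max 2 ((L2_set x {..<d})\<^sup>2)"
  show "integrable \<rho> (\<lambda>t. ?C * min 1 ((L2_set t {..<d})\<^sup>2))"
    using finite_min by (intro integrable_mult_right integrableI_nonneg) auto
  show "(\<lambda>t. 1 - cos (dot d x t)) \<in> borel_measurable \<rho>" by measurable
  show "AE t in \<rho>. norm (1 - cos (dot d x t)) \<le> norm (?C * min 1 ((L2_set t {..<d})\<^sup>2))"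
  proof (rule AE_I2)
    fix t
    let ?x = "L2_set x {..<d}" and ?t = "L2_set t {..<d}" and ?s = "dot d x t"
    have "\<bar>?s\<bar> \<le> (\<Sum>j<d. \<bar>x j\<bar> * \<bar>t j\<bar>)"
      unfolding dot_def by (rule order_trans[OF sum_abs]) (simp add: abs_mult)
    also have "\<dots> \<le> ?x * ?t" by (rule L2_set_mult_ineq)
    finally have "?s\<^sup>2 \<le> (?x * ?t)\<^sup>2"
      by (metis abs_ge_zero power2_abs power_mono)
    moreover have "1 - cos ?s \<le> ?s\<^sup>2"
    proof -
      have "1 - cos ?s = 2 * (sin (?s / 2))\<^sup>2"
        using cos_double_sin[of "?s / 2"] by simp
      also have "\<dots> \<le> 2 * (?s / 2)\<^sup>2"
        by (metis abs_ge_zero abs_sin_x_le_abs_x power2_abs power_mono mult_left_mono zero_le_numeral)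
      also have "\<dots> \<le> ?s\<^sup>2" by (simp add: power_divide)
      finally show ?thesis .
    qed
    ultimately have "1 - cos ?s \<le> ?x\<^sup>2 * ?t\<^sup>2" by (simp add: power_mult_distrib)
    moreover have "?x\<^sup>2 * ?t\<^sup>2 \<le> ?C * ?t\<^sup>2" by (intro mult_right_mono) auto
    moreover have "1 - cos ?s \<le> 2" using cos_ge_minus_one[of ?s] by linarith
    moreover have "1 - cos ?s \<ge> 0" by simp
    moreover have "2 \<le> ?C" by simp
    ultimately have "1 - cos ?s \<le> ?C * min 1 (?t\<^sup>2)" "0 \<le> 1 - cos ?s" by (auto simp only: min_def split: if_splits; linarith)+
    then show "norm (1 - cos ?s) \<le> norm (?C * min 1 (?t\<^sup>2))" by (simp only: real_norm_def)
  qed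
qed

lemma psi_nonneg: "0 \<le> psi d \<rho> x"
  unfolding psi_def by (rule Bochner_Integration.integral_nonneg) simp

lemma psi_vdiff_self: "psi d \<rho> (vdiff d x x) = 0"
  by (simp add: psi_def dot_vdiff)

lemma psi_vdiff_commute: "psi d \<rho> (vdiff d x y) = psi d \<rho> (vdiff d y x)"
  by (simp add: psi_def dot_vdiff cos_diff mult.commute)

text \<open>This bound transfers square integrability from \<open>\<psi>(X)\<close> to
  \<open>\<psi>(X - X')\<close>. It is the integral of a pointwise inequality between
  cosines.\<close>

lemma psi_vdiff_le: "psi d \<rho> (vdiff d x y) \<le> 2 * psi d \<rho> x + 2 * psi d \<rho> y"
proof -
  have "1 - cos (a - b) \<le> 2 * (1 - cos a) + 2 * (1 - cos b)" for a b :: real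
  proof -
    have cos_mult_self: "cos s * cos s = 1 - sin s * sin s" for s :: real
      using sin_cos_squared_add[of s] by (simp add: power2_eq_square algebra_simps)
    \<comment> \<open>This is the parallelogram law for \<open>u = e^(ia) - 1\<close> and
      \<open>v = e^(ib) - 1\<close>: the squares of \<open>|u|\<close>, \<open>|v|\<close> and
      \<open>|u - v|\<close> are twice the three terms \<open>1 - cos\<close>, and the right-hand
      side is half the square of \<open>|u + v|\<close>.\<close>
    have "2 * (1 - cos a) + 2 * (1 - cos b) - (1 - cos (a - b))
        = ((cos a + cos b - 2)\<^sup>2 + (sin a + sin b)\<^sup>2) / 2"
      by (simp add: power2_eq_square algebra_simps cos_diff cos_mult_self)
    also have "\<dots> \<ge> 0" by simp
    finally show ?thesis by simp
  qed
  then have "psi d \<rho> (vdiff d x y) \<le> (\<integral>t. 2 * (1 - cos (dot d x t)) + 2 * (1 - cos (dot d y t)) \<partial>\<rho>)"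
    unfolding psi_def
    by (intro integral_mono integrable_one_minus_cos Bochner_Integration.integrable_add
          integrable_mult_right) (simp only: dot_vdiff)
  also have "\<dots> = 2 * psi d \<rho> x + 2 * psi d \<rho> y"
    unfolding psi_def by (simp only: Bochner_Integration.integral_add integrable_mult_right
        integral_mult_right_zero integrable_one_minus_cos)
  finally show ?thesis .
qed

text \<open>Measurability of an integral in its parameter is obtained from a sigma-finite measure.
  Discarding the origin supplies one and keeps the integral, because the integrand vanishes
  there.\<close>

lemma measurable_psi [measurable]: "psi d \<rho> \<in> borel_measurable (Rd d)"
proof -
  interpret D: sigma_finite_measure "density \<rho> (indicator (- {origin d}))"
    by (rule sigma_finite_off_origin)
  have "psi d \<rho> = (\<lambda>x. \<integral>t. 1 - cos (dot d x t) \<partial>density \<rho> (\<lambda>t. ennreal (indicator (- {origin d}) t)))"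
  proof
    fix x
    have "(\<integral>t. 1 - cos (dot d x t) \<partial>density \<rho> (\<lambda>t. ennreal (indicator (- {origin d}) t)))
        = (\<integral>t. indicator (- {origin d}) t *\<^sub>R (1 - cos (dot d x t)) \<partial>\<rho>)"
      by (intro integral_density borel_measurable_indicator_Compl_singleton[OF sets_origin_rho]) auto
    also have "\<dots> = psi d \<rho> x"
      unfolding psi_def by (intro Bochner_Integration.integral_cong) (auto simp: indicator_def)
    finally show "psi d \<rho> x = (\<integral>t. 1 - cos (dot d x t) \<partial>density \<rho> (\<lambda>t. ennreal (indicator (- {origin d}) t)))" ..
  qed
  also have "\<dots> \<in> borel_measurable (Rd d)"
    unfolding ennreal_indicator by (intro D.borel_measurable_lebesgue_integral) measurable
  finally show ?thesis .
qed

end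

subsection \<open>Sample multivariance as a sum of products\<close>

definition centering :: "nat \<Rightarrow> nat \<Rightarrow> nat \<Rightarrow> real" where
  "centering N j k = (if j = k then 1 else 0) - 1 / real N"

lemma sum_centering: "j \<in> {1..N} \<Longrightarrow> (\<Sum>a=1..N. centering N j a) = 0"
  by (simp add: centering_def sum_subtractf)

text \<open>Entry \<open>(j, k)\<close> of \<open>- C B C\<close>; the symmetry of \<open>C\<close>
  allows the right factor to be written with the indices \<open>k, b\<close>.\<close>

definition double_centered :: "nat \<Rightarrow> (nat \<Rightarrow> nat \<Rightarrow> real) \<Rightarrow> nat \<Rightarrow> nat \<Rightarrow> real" where
  "double_centered N B j k = - (\<Sum>a=1..N. \<Sum>b=1..N. centering N j a * centering N k b * B a b)"

text \<open>For \<open>j\<close> in \<open>{1..N}\<close> this is the factor of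
  \<open>sampleZ\<close> that belongs to observation \<open>j\<close> in one coordinate.\<close>

definition centered_char :: "nat \<Rightarrow> nat \<Rightarrow> (nat \<Rightarrow> nat \<Rightarrow> real) \<Rightarrow> nat \<Rightarrow> (nat \<Rightarrow> real) \<Rightarrow> complex" where
  "centered_char d N x j t = (\<Sum>a=1..N. centering N j a * cis (dot d (x a) t))"

lemma centered_char_eq:
  assumes "j \<in> {1..N}"
  shows "exp (\<i> * complex_of_real (dot d (x j) t))
      - 1 / of_nat N * (\<Sum>k=1..N. exp (\<i> * complex_of_real (dot d (x k) t))) = centered_char d N x j t"
proof -
  have "centered_char d N x j t = (\<Sum>a=1..N. (if j = a then cis (dot d (x a) t) else 0)
      - 1 / of_nat N * cis (dot d (x a) t))"
    unfolding centered_char_def centering_def by (intro sum.cong) (auto simp: left_diff_distrib)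
  then show ?thesis
    using assms by (simp add: sum_subtractf sum_distrib_left cis_conv_exp)
qed

lemma centered_char_mult_cnj:
  "centered_char d N x j t * cnj (centered_char d N x k t)
    = (\<Sum>a=1..N. \<Sum>b=1..N. of_real (centering N j a * centering N k b) * cis (dot d (vdiff d (x a) (x b)) t))"
proof -
  have "(of_real z * cis u) * cnj (of_real w * cis v) = of_real (z * w) * cis (u - v)" for z w u v
  proof -
    have "cis (u - v) = cis u * cnj (cis v)" by (simp add: cis_cnj cis_mult)
    then show ?thesis by simp
  qed
  then show ?thesis
    unfolding centered_char_def cnj_sum sum_product by (simp only: dot_vdiff)
qed

text \<open>Because the rows of \<open>C\<close> sum to zero, \<open>cos\<close> may be replaced by
  \<open>cos - 1\<close>. This matters for integration: \<open>1 - cos\<close> is integrable even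
  when \<open>\<rho>\<close> is infinite.\<close>

lemma Re_centered_char_mult_cnj:
  assumes "j \<in> {1..N}"
  shows "Re (centered_char d N x j t * cnj (centered_char d N x k t))
    = double_centered N (\<lambda>a b. 1 - cos (dot d (vdiff d (x a) (x b)) t)) j k"
proof -
  have "(\<Sum>a=1..N. \<Sum>b=1..N. centering N j a * centering N k b) = 0"
    using sum_centering[OF assms] by (simp flip: sum_product)
  then show ?thesis
    by (simp add: centered_char_mult_cnj double_centered_def right_diff_distrib sum_subtractf)
qed

lemma centered_char_uminus:
  "centered_char d N x j (\<lambda>i\<in>{..<d}. - t i) = cnj (centered_char d N x j t)"
  by (simp add: centered_char_def dot_uminus cis_cnj)

lemma centered_char_origin: "j \<in> {1..N} \<Longrightarrow> centered_char d N x j (origin d) = 0"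
  using sum_centering[of j N] by (simp add: centered_char_def flip: of_real_sum)

lemma measurable_centered_char [measurable]: "centered_char d N x j \<in> borel_measurable (Rd d)"
proof -
  have "(\<lambda>t. cis (dot d y t)) \<in> borel_measurable (Rd d)" for y
    unfolding cis_conv_exp by measurable
  then show ?thesis unfolding centered_char_def[abs_def] by measurable
qed

context admissible
begin

text \<open>The real part is a finite combination of integrable functions \<open>1 - cos\<close>. It
  controls the whole product: \<open>|u v| \<le> |u|^2 + |v|^2\<close>, and both squares are real
  parts of diagonal products. The imaginary part integrates to zero, because the reflection of
  \<open>t\<close> preserves \<open>\<rho>\<close> and conjugates the integrand.\<close>

lemma
  assumes j: "j \<in> {1..N}" and k: "k \<in> {1..N}"
  shows integrable_centered_char: "integrable \<rho> (\<lambda>t. centered_char d N x j t * cnj (centered_char d N x k t))" (is "integrable \<rho> (?f j k)")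
    and integral_centered_char: "(\<integral>t. centered_char d N x j t * cnj (centered_char d N x k t) \<partial>\<rho>)
      = of_real (double_centered N (\<lambda>a b. psi d \<rho> (vdiff d (x a) (x b))) j k)"
proof -
  have "cnj \<in> borel_measurable borel"
    by (intro borel_measurable_continuous_onI continuous_on_cnj continuous_on_id)
  then have m: "?f j k \<in> borel_measurable (Rd d)" for j k
    by (intro borel_measurable_times measurable_compose[OF measurable_centered_char, of cnj]) auto
  have Re: "integrable \<rho> (\<lambda>t. Re (?f j k t))"
    "(\<integral>t. Re (?f j k t) \<partial>\<rho>) = double_centered N (\<lambda>a b. psi d \<rho> (vdiff d (x a) (x b))) j k"
    if "j \<in> {1..N}" for j k
    unfolding Re_centered_char_mult_cnj[OF that] double_centered_def psi_def
    by (simp_all add: integrable_one_minus_cos)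
  show f: "integrable \<rho> (?f j k)"
  proof (rule Bochner_Integration.integrable_bound)
    show "integrable \<rho> (\<lambda>t. Re (?f j j t) + Re (?f k k t))"
      using Re(1) j k by (intro Bochner_Integration.integrable_add) blast+
    show "?f j k \<in> borel_measurable \<rho>" using m sets_rho by (simp cong: measurable_cong_sets)
    show "AE t in \<rho>. norm (?f j k t) \<le> norm (Re (?f j j t) + Re (?f k k t))"
    proof (rule AE_I2)
      fix t
      let ?a = "cmod (centered_char d N x j t)" and ?b = "cmod (centered_char d N x k t)"
      have "0 \<le> ?a * ?b" by simp
      with sum_squares_bound[of ?a ?b] have "?a * ?b \<le> ?a\<^sup>2 + ?b\<^sup>2" by linarith
      moreover have "0 \<le> ?a\<^sup>2 + ?b\<^sup>2" by simp
      ultimately show "norm (?f j k t) \<le> norm (Re (?f j j t) + Re (?f k k t))"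
        by (simp add: norm_mult complex_norm_square[symmetric] flip: of_real_power)
    qed
  qed
  have "(\<integral>t. ?f j k t \<partial>\<rho>) = (\<integral>t. ?f j k (\<lambda>j\<in>{..<d}. - t j) \<partial>\<rho>)"
  proof -
    have "(\<lambda>t. \<lambda>j\<in>{..<d}. - t j) \<in> Rd d \<rightarrow>\<^sub>M Rd d"
      by (subst (2) Rd_def, rule measurable_restrict) measurable
    then have "(\<lambda>t. \<lambda>j\<in>{..<d}. - t j) \<in> \<rho> \<rightarrow>\<^sub>M Rd d"
      using sets_rho by (simp cong: measurable_cong_sets)
    then show ?thesis
      using m by (subst symmetric[symmetric]) (rule integral_distr)
  qed
  also have "\<dots> = (\<integral>t. cnj (?f j k t) \<partial>\<rho>)"
    by (simp only: centered_char_uminus complex_cnj_mult)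
  also have "\<dots> = cnj (\<integral>t. ?f j k t \<partial>\<rho>)" by (rule Bochner_Integration.integral_cnj)
  finally have "Im (\<integral>t. ?f j k t \<partial>\<rho>) = 0"
    by (metis Reals_cnj_iff complex_is_Real_iff)
  moreover have "Re (\<integral>t. ?f j k t \<partial>\<rho>) = double_centered N (\<lambda>a b. psi d \<rho> (vdiff d (x a) (x b))) j k"
    using Re(2)[OF j] f by (metis integral_Re)
  ultimately show "(\<integral>t. ?f j k t \<partial>\<rho>) = of_real (double_centered N (\<lambda>a b. psi d \<rho> (vdiff d (x a) (x b))) j k)"
    by (simp add: complex_eq_iff)
qed

end

text \<open>This is the passage from the integral form of the multivariance to its matrix form. Each
  summand of the expanded square is a product over \<open>i\<close> whose factors vanish at the
  origin, so it integrates factor by factor.\<close>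

lemma sample_multivariance_square:
  assumes "\<And>i. i \<in> {1..n} \<Longrightarrow> admissible_measure (d i) (\<rho> i)"
  shows "(sample_multivariance n d \<rho> N x)\<^sup>2 = 1 / (real N)\<^sup>2 * (\<Sum>j=1..N. \<Sum>k=1..N. \<Prod>i=1..n.
           double_centered N (\<lambda>a b. psi (d i) (\<rho> i) (vdiff (d i) (x a i) (x b i))) j k)"
proof -
  have adm: "admissible (d i) (\<rho> i)" if "i \<in> {1..n}" for i
    using assms[OF that] by (rule admissible.intro)
  let ?P = "\<Pi>\<^sub>M i\<in>{1..n}. \<rho> i"
  let ?c = "\<lambda>j i. centered_char (d i) N (\<lambda>l. x l i) j"
  let ?B = "\<lambda>i a b. psi (d i) (\<rho> i) (vdiff (d i) (x a i) (x b i))"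
  have Z: "complex_of_real ((cmod (sampleZ n d N x t))\<^sup>2) =
      (\<Sum>j=1..N. \<Sum>k=1..N. 1 / (of_nat N)\<^sup>2 * (\<Prod>i=1..n. ?c j i (t i) * cnj (?c k i (t i))))" for t
  proof -
    have "sampleZ n d N x t = 1 / of_nat N * (\<Sum>j=1..N. \<Prod>i=1..n. ?c j i (t i))"
      unfolding sampleZ_def
      by (intro arg_cong2[where f = "(*)"] sum.cong prod.cong refl centered_char_eq)
    then have "complex_of_real ((cmod (sampleZ n d N x t))\<^sup>2) =
        1 / (of_nat N)\<^sup>2 * (\<Sum>j=1..N. \<Sum>k=1..N. (\<Prod>i=1..n. ?c j i (t i)) * (\<Prod>i=1..n. cnj (?c k i (t i))))"
      by (simp only: complex_norm_square) (simp add: power2_eq_square sum_product)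
    then show ?thesis by (simp only: sum_distrib_left prod.distrib)
  qed
  have int: "integrable ?P (\<lambda>t. \<Prod>i=1..n. ?c j i (t i) * cnj (?c k i (t i)))"
      "(\<integral>t. (\<Prod>i=1..n. ?c j i (t i) * cnj (?c k i (t i))) \<partial>?P)
        = of_real (\<Prod>i=1..n. double_centered N (?B i) j k)"
    if "j \<in> {1..N}" "k \<in> {1..N}" for j k
  proof -
    note prod_atom = integral_PiM_prod_atom[where f = "\<lambda>i t. ?c j i t * cnj (?c k i t)"
        and p = "\<lambda>i. origin (d i)" and M = \<rho> and I = "{1..n}",
      OF _ admissible.sets_origin_rho[OF adm] admissible.sigma_finite_off_origin[OF adm]
        admissible.integrable_centered_char[OF adm that]]
    show "integrable ?P (\<lambda>t. \<Prod>i=1..n. ?c j i (t i) * cnj (?c k i (t i)))"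
      using that by (intro prod_atom(1)) (simp_all add: centered_char_origin)
    have "(\<integral>t. (\<Prod>i=1..n. ?c j i (t i) * cnj (?c k i (t i))) \<partial>?P)
        = (\<Prod>i=1..n. \<integral>t. ?c j i t * cnj (?c k i t) \<partial>\<rho> i)"
      using that by (intro prod_atom(2)) (simp_all add: centered_char_origin)
    also have "\<dots> = (\<Prod>i=1..n. of_real (double_centered N (?B i) j k))"
      using that by (intro prod.cong refl admissible.integral_centered_char adm)
    finally show "(\<integral>t. (\<Prod>i=1..n. ?c j i (t i) * cnj (?c k i (t i))) \<partial>?P)
        = of_real (\<Prod>i=1..n. double_centered N (?B i) j k)" by simp
  qed
  \<comment> \<open>The computation is carried out over the complex numbers, since the single
    summands are complex-valued and only their integrals are known to be real.\<close>
  have "complex_of_real (\<integral>t. (cmod (sampleZ n d N x t))\<^sup>2 \<partial>?P)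
      = (\<integral>t. (\<Sum>j=1..N. \<Sum>k=1..N. 1 / (of_nat N)\<^sup>2 * (\<Prod>i=1..n. ?c j i (t i) * cnj (?c k i (t i)))) \<partial>?P)"
    by (simp only: Z flip: integral_complex_of_real)
  also have "\<dots> = (\<Sum>j=1..N. \<Sum>k=1..N. 1 / (of_nat N)\<^sup>2 * of_real (\<Prod>i=1..n. double_centered N (?B i) j k))"
  proof -
    let ?g = "\<lambda>j k t. 1 / (complex_of_nat N)\<^sup>2 * (\<Prod>i=1..n. ?c j i (t i) * cnj (?c k i (t i)))"
    have g: "integrable ?P (?g j k)" if "j \<in> {1..N}" "k \<in> {1..N}" for j k
      using int(1)[OF that] by (rule integrable_mult_right)
    have "(\<integral>t. (\<Sum>j=1..N. \<Sum>k=1..N. ?g j k t) \<partial>?P) = (\<Sum>j=1..N. \<integral>t. (\<Sum>k=1..N. ?g j k t) \<partial>?P)"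
      by (rule Bochner_Integration.integral_sum) (intro Bochner_Integration.integrable_sum g)
    also have "\<dots> = (\<Sum>j=1..N. \<Sum>k=1..N. \<integral>t. ?g j k t \<partial>?P)"
      by (intro sum.cong refl Bochner_Integration.integral_sum g)
    also have "\<dots> = (\<Sum>j=1..N. \<Sum>k=1..N. 1 / (of_nat N)\<^sup>2 * of_real (\<Prod>i=1..n. double_centered N (?B i) j k))"
      using int by (intro sum.cong refl) (simp only: integral_mult_right_zero)
    finally show ?thesis .
  qed
  also have "\<dots> = of_real (1 / (real N)\<^sup>2 * (\<Sum>j=1..N. \<Sum>k=1..N. \<Prod>i=1..n. double_centered N (?B i) j k))"
    by (simp add: sum_distrib_left)
  finally have "(\<integral>t. (cmod (sampleZ n d N x t))\<^sup>2 \<partial>?P)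
      = 1 / (real N)\<^sup>2 * (\<Sum>j=1..N. \<Sum>k=1..N. \<Prod>i=1..n. double_centered N (?B i) j k)"
    by (simp only: of_real_eq_iff)
  moreover have "0 \<le> (\<integral>t. (cmod (sampleZ n d N x t))\<^sup>2 \<partial>?P)"
    by (rule Bochner_Integration.integral_nonneg) simp
  ultimately show ?thesis
    unfolding sample_multivariance_def by (simp only: real_sqrt_pow2)
qed

subsection \<open>Sums over the centering matrix\<close>

abbreviation \<delta> :: "nat \<Rightarrow> nat \<Rightarrow> real" where
  "\<delta> j k \<equiv> of_bool (j = k)"

lemma sum_mult_delta:
  assumes "a \<in> {1..N}"
  shows "(\<Sum>b=1..N. f b * \<delta> a b) = f a" "(\<Sum>b=1..N. f b * \<delta> b a) = f a"
  using assms by (simp_all add: of_bool_def if_distrib[where f = "(*) _"] cong: if_cong)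

text \<open>The projection identity \<open>C^2 = C\<close> for the symmetric matrix
  \<open>C\<close>.\<close>

lemma sum_centering_mult:
  assumes "j \<in> {1..N}" "k \<in> {1..N}"
  shows "(\<Sum>a=1..N. centering N j a * centering N k a) = centering N j k"
proof -
  have "(\<Sum>a=1..N. centering N j a * centering N k a)
      = (\<Sum>a=1..N. centering N j a * \<delta> k a) - (\<Sum>a=1..N. centering N j a) / N"
    by (simp add: centering_def[of N k] of_bool_def right_diff_distrib sum_subtractf sum_divide_distrib)
  then show ?thesis using assms by (simp add: sum_mult_delta sum_centering[simplified])
qed

text \<open>The quantity \<open>Q\<close> from above. It arises from monomials that identify all
  four summation indices.\<close>

definition centering4 :: "nat \<Rightarrow> nat \<Rightarrow> nat \<Rightarrow> nat \<Rightarrow> nat \<Rightarrow> real" where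
  "centering4 N j k l m = (\<Sum>a=1..N. centering N j a * centering N k a * centering N l a * centering N m a)"

text \<open>The four factors \<open>\<delta> - 1/N\<close> are multiplied out, and summation over
  \<open>a\<close> removes one delta from every term that contains any. The four terms with a single
  delta give \<open>-4/N^3\<close>, the constant term gives \<open>N/N^4\<close>, and together they
  make \<open>-3/N^3\<close>.\<close>

lemma centering4_eq:
  assumes "j \<in> {1..N}" "k \<in> {1..N}" "l \<in> {1..N}" "m \<in> {1..N}"
  shows "centering4 N j k l m = of_bool (j = k \<and> j = l \<and> j = m)
    - (of_bool (j = k \<and> j = l) + of_bool (j = k \<and> j = m) + of_bool (j = l \<and> j = m) + of_bool (k = l \<and> k = m)) / N
    + (\<delta> j k + \<delta> j l + \<delta> j m + \<delta> k l + \<delta> k m + \<delta> l m) / N ^ 2 - 3 / N ^ 3"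
proof -
  let ?r = "1 / real N"
  have N: "real N > 0" using assms by auto
  have expand: "(\<delta> j a - r) * (\<delta> k a - r) * (\<delta> l a - r) * (\<delta> m a - r) = of_bool (j = k \<and> j = l \<and> j = m) * \<delta> j a
      - r * (of_bool (j = k \<and> j = l) * \<delta> j a) - r * (of_bool (j = k \<and> j = m) * \<delta> j a)
      - r * (of_bool (j = l \<and> j = m) * \<delta> j a) - r * (of_bool (k = l \<and> k = m) * \<delta> k a)
      + r^2 * (\<delta> j k * \<delta> j a) + r^2 * (\<delta> j l * \<delta> j a) + r^2 * (\<delta> j m * \<delta> j a)
      + r^2 * (\<delta> k l * \<delta> k a) + r^2 * (\<delta> k m * \<delta> k a) + r^2 * (\<delta> l m * \<delta> l a)
      - r^3 * \<delta> j a - r^3 * \<delta> k a - r^3 * \<delta> l a - r^3 * \<delta> m a + r^4"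
    for a and r :: real
    by (cases "j = a"; cases "k = a"; cases "l = a"; cases "m = a")
      (simp_all add: power2_eq_square power3_eq_cube power4_eq_xxxx algebra_simps)
  have "centering N x a = \<delta> x a - ?r" for x a by (simp add: centering_def of_bool_def)
  then have "centering4 N j k l m = (\<Sum>a=1..N. of_bool (j = k \<and> j = l \<and> j = m) * \<delta> j a
      - ?r * (of_bool (j = k \<and> j = l) * \<delta> j a) - ?r * (of_bool (j = k \<and> j = m) * \<delta> j a)
      - ?r * (of_bool (j = l \<and> j = m) * \<delta> j a) - ?r * (of_bool (k = l \<and> k = m) * \<delta> k a)
      + ?r^2 * (\<delta> j k * \<delta> j a) + ?r^2 * (\<delta> j l * \<delta> j a) + ?r^2 * (\<delta> j m * \<delta> j a)
      + ?r^2 * (\<delta> k l * \<delta> k a) + ?r^2 * (\<delta> k m * \<delta> k a) + ?r^2 * (\<delta> l m * \<delta> l a)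
      - ?r^3 * \<delta> j a - ?r^3 * \<delta> k a - ?r^3 * \<delta> l a - ?r^3 * \<delta> m a + ?r^4)"
    unfolding centering4_def by (simp only: expand)
  also have "\<dots> = of_bool (j = k \<and> j = l \<and> j = m)
      - ?r * of_bool (j = k \<and> j = l) - ?r * of_bool (j = k \<and> j = m)
      - ?r * of_bool (j = l \<and> j = m) - ?r * of_bool (k = l \<and> k = m)
      + ?r^2 * \<delta> j k + ?r^2 * \<delta> j l + ?r^2 * \<delta> j m
      + ?r^2 * \<delta> k l + ?r^2 * \<delta> k m + ?r^2 * \<delta> l m
      - ?r^3 - ?r^3 - ?r^3 - ?r^3 + N * ?r^4"
    using assms by (simp only: sum.distrib sum_subtractf sum_distrib_left[symmetric] sum_mult_delta) simp
  also have "N * ?r^4 = ?r^3" using N by (simp add: power_divide power4_eq_xxxx power3_eq_cube)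
  finally show ?thesis by (simp add: power_divide add_divide_distrib)
qed

text \<open>The closed form of \<open>E A_{j,k} A_{l,m}\<close> for a single coordinate;
  \<open>d\<close> is the square of the first moment.\<close>

definition moment2 :: "nat \<Rightarrow> real \<Rightarrow> real \<Rightarrow> real \<Rightarrow> nat \<Rightarrow> nat \<Rightarrow> nat \<Rightarrow> nat \<Rightarrow> real" where
  "moment2 N b c d j k l m = d * (centering N j k * centering N l m)
     + 4 * (c - d) * centering4 N j k l m
     + (b - 2 * c + d) * (centering N j l * centering N k m + centering N j m * centering N k l
         - 2 * centering4 N j k l m)"

text \<open>The row of the coefficient table that applies to \<open>(j, k, l, m)\<close>.\<close>

definition pattern_class :: "nat \<Rightarrow> nat \<Rightarrow> nat \<Rightarrow> nat \<Rightarrow> nat" where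
  "pattern_class j k l m =
    (if j = k then
       (if l = m then (if j = l then 7 else 4) else if l = j \<or> m = j then 5 else 6)
     else if l = m then (if l = j \<or> l = k then 5 else 6)
     else if (l = j \<and> m = k) \<or> (l = k \<and> m = j) then 2
     else if l = j \<or> l = k \<or> m = j \<or> m = k then 3
     else 1)"

text \<open>After multiplication by \<open>N^4\<close> both sides are polynomials in
  \<open>N\<close>; in \<open>F\<close>, the number \<open>q\<close> is \<open>N^4\<close> times
  \<open>centering4\<close>. Splitting on the six equalities among \<open>j, k, l, m\<close> leaves
  a polynomial identity with one row of the table in each consistent case.\<close>

lemma moment2_eq_coeff:
  assumes "j \<in> {1..N}" "k \<in> {1..N}" "l \<in> {1..N}" "m \<in> {1..N}"
  shows "moment2 N b c d j k l m = (coeffb N (pattern_class j k l m) * b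
     + coeffc N (pattern_class j k l m) * c + coeffd N (pattern_class j k l m) * d) / real N ^ 4"
proof -
  have N: "real N \<noteq> 0" using assms by auto
  have F: "moment2 N b c d j k l m = (d * ((real N * \<delta> j k - 1) * (real N * \<delta> l m - 1) * real N ^ 2) + 4 * (c - d) * q
      + (b - 2 * c + d) * ((real N * \<delta> j l - 1) * (real N * \<delta> k m - 1) * real N ^ 2 + (real N * \<delta> j m - 1) * (real N * \<delta> k l - 1) * real N ^ 2 - 2 * q)) / real N ^ 4"
    if q: "q = real N ^ 4 * of_bool (j = k \<and> j = l \<and> j = m)
    - real N ^ 3 * (of_bool (j = k \<and> j = l) + of_bool (j = k \<and> j = m) + of_bool (j = l \<and> j = m) + of_bool (k = l \<and> k = m))
    + real N ^ 2 * (\<delta> j k + \<delta> j l + \<delta> j m + \<delta> k l + \<delta> k m + \<delta> l m) - 3 * real N" for q :: real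
  proof -
    have 4: "centering4 N j k l m = q / real N ^ 4"
      unfolding centering4_eq[OF assms] q using N
      by (simp add: diff_divide_distrib add_divide_distrib power4_eq_xxxx power2_eq_square power3_eq_cube)
    have 1: "centering N x y = (real N * \<delta> x y - 1) / N" for x y
      using N by (simp add: centering_def of_bool_def diff_divide_distrib)
    show ?thesis
      unfolding moment2_def 1 4 using N
      by (simp add: power4_eq_xxxx power2_eq_square divide_simps) (simp add: algebra_simps)
  qed
  show ?thesis
    unfolding F[OF refl] pattern_class_def coeffb_def coeffc_def coeffd_def coeff_table_def
    by (cases "j = k"; cases "j = l"; cases "j = m"; cases "k = l"; cases "k = m"; cases "l = m")
      (simp_all add: nth_Cons' power4_eq_xxxx power2_eq_square power3_eq_cube,
       simp_all add: algebra_simps)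
qed

section \<open>Counting index quadruples by their coincidences\<close>

lemma sum_constant_off:
  fixes f :: "nat \<Rightarrow> real"
  assumes S: "S \<subseteq> {1..N}" and off: "\<And>x. x \<in> {1..N} - S \<Longrightarrow> f x = v"
  shows "(\<Sum>x=1..N. f x) = (\<Sum>x\<in>S. f x) + (real N - real (card S)) * v"
proof -
  have "finite S" "card S \<le> N" using S card_mono[OF _ S] by (auto intro: finite_subset)
  moreover have "(\<Sum>x=1..N. f x) = (\<Sum>x\<in>{1..N}-S. f x) + (\<Sum>x\<in>S. f x)"
    using S by (intro sum.subset_diff) auto
  moreover have "(\<Sum>x\<in>{1..N}-S. f x) = (\<Sum>x\<in>{1..N}-S. v)" using off by (rule sum.cong[OF refl])
  ultimately show ?thesis using S by (simp add: card_Diff_subset of_nat_diff)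
qed

text \<open>The coefficient \<open>C(N, k)\<close> is the number of quadruples in class
  \<open>k\<close>. The sums are evaluated from the inside outwards, each time separating the
  indices that coincide with one fixed earlier.\<close>

lemma sum_pattern_class:
  fixes g :: "nat \<Rightarrow> real"
  shows "(\<Sum>j=1..N. \<Sum>k=1..N. \<Sum>l=1..N. \<Sum>m=1..N. g (pattern_class j k l m))
    = (\<Sum>k=1..7. coeffC N k * g k)"
proof -
  let ?n = "real N"
  let ?G4 = "\<lambda>j k l. \<Sum>m=1..N. g (pattern_class j k l m)"
  \<comment> \<open>These are the partial sums: \<open>?e\<close> is the sum over \<open>m\<close>
    when \<open>j = k\<close> and \<open>l\<close> differs from \<open>j\<close>, and
    \<open>?h\<close> the one when \<open>j, k, l\<close> are distinct. \<open>?E\<close> and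
    \<open>?H\<close> are the sums over \<open>l\<close> and \<open>m\<close> for
    \<open>j = k\<close> and for \<open>j \<noteq> k\<close>.\<close>
  let ?e = "g 5 + g 4 + (?n - 2) * g 6" and ?h = "2 * g 3 + g 6 + (?n - 3) * g 1"
  let ?E = "(g 7 + (?n - 1) * g 5) + (?n - 1) * ?e"
    and ?H = "2 * (g 5 + g 2 + (?n - 2) * g 3) + (?n - 2) * ?h"
  have jj: "(\<Sum>l=1..N. ?G4 j j l) = ?E" if j: "j \<in> {1..N}" for j
  proof -
    have "?G4 j j l = ?e" if "l \<in> {1..N} - {j}" for l
      using that j sum_constant_off[of "{j, l}" N "\<lambda>m. g (pattern_class j j l m)" "g 6"]
      by (auto simp: pattern_class_def)
    moreover have "?G4 j j j = g 7 + (?n - 1) * g 5"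
      using j sum_constant_off[of "{j}" N "\<lambda>m. g (pattern_class j j j m)" "g 5"]
      by (auto simp: pattern_class_def)
    ultimately show ?thesis
      using j sum_constant_off[of "{j}" N "?G4 j j" ?e] by simp
  qed
  have jk: "(\<Sum>l=1..N. ?G4 j k l) = ?H" if j: "j \<in> {1..N}" and k: "k \<in> {1..N} - {j}" for j k
  proof -
    have "?G4 j k l = ?h" if "l \<in> {1..N} - {j, k}" for l
      using that j k sum_constant_off[of "{j, k, l}" N "\<lambda>m. g (pattern_class j k l m)" "g 1"]
      by (auto simp: pattern_class_def)
    moreover have "?G4 j k l = g 5 + g 2 + (?n - 2) * g 3" if "l = j \<or> l = k" for l
    proof -
      have "?G4 j k l = (\<Sum>m\<in>{j, k}. g (pattern_class j k l m)) + (?n - real (card {j, k})) * g 3"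
        using that j k by (intro sum_constant_off) (auto simp: pattern_class_def)
      then show ?thesis using that j k by (auto simp: pattern_class_def)
    qed
    ultimately show ?thesis
      using j k sum_constant_off[of "{j, k}" N "?G4 j k" ?h] by auto
  qed
  have "(\<Sum>k=1..N. \<Sum>l=1..N. ?G4 j k l) = ?E + (?n - 1) * ?H" if j: "j \<in> {1..N}" for j
    using j sum_constant_off[of "{j}" N "\<lambda>k. \<Sum>l=1..N. ?G4 j k l" ?H] jj[OF j] jk[OF j] by simp
  then have "(\<Sum>j=1..N. \<Sum>k=1..N. \<Sum>l=1..N. \<Sum>m=1..N. g (pattern_class j k l m))
      = ?n * (?E + (?n - 1) * ?H)"
    by simp
  also have "\<dots> = (\<Sum>k=1..7. coeffC N k * g k)"
  proof -
    have seven: "{1..7} = {1, 2, 3, 4, 5, 6, 7::nat}" by auto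
    show ?thesis
      unfolding seven by (simp add: coeffC_def coeff_table_def) (simp add: algebra_simps)
  qed
  finally show ?thesis .
qed

section \<open>Centering of polynomials in Kronecker deltas\<close>

lemma sum2_mult_sum2:
  fixes u v :: "nat \<Rightarrow> nat \<Rightarrow> real"
  shows "(\<Sum>p\<in>I. \<Sum>q\<in>I. u p q) * (\<Sum>r\<in>I. \<Sum>s\<in>I. v r s) = (\<Sum>p\<in>I. \<Sum>q\<in>I. \<Sum>r\<in>I. \<Sum>s\<in>I. u p q * v r s)"
  by (simp only: sum_distrib_right) (simp only: sum_distrib_left)

text \<open>The operator \<open>?S\<close> applies \<open>C\<close> in each of the four indices. It
  annihilates every function that ignores one of them, because the rows of \<open>C\<close> sum to
  zero. Splitting such parts off \<open>G\<close> leaves \<open>U\<close>, whose monomials tie every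
  index to another one.\<close>

lemma sum_centering_pair_moments:
  fixes b c d :: real
  assumes "j \<in> {1..N}" "k \<in> {1..N}" "l \<in> {1..N}" "m \<in> {1..N}"
    and G: "\<And>p q r s. G p q r s = (1 - \<delta> p q) * (1 - \<delta> r s) * (d + (c - d) * (\<delta> p r + \<delta> p s + \<delta> q r + \<delta> q s)
      + (b - 2 * c + d) * (\<delta> p r * \<delta> q s + \<delta> p s * \<delta> q r))"
  shows "(\<Sum>p=1..N. centering N j p * (\<Sum>q=1..N. centering N k q * (\<Sum>r=1..N. centering N l r *
    (\<Sum>s=1..N. centering N m s * G p q r s)))) = moment2 N b c d j k l m"
proof -
  let ?S = "\<lambda>F. \<Sum>p=1..N. centering N j p * (\<Sum>q=1..N. centering N k q * (\<Sum>r=1..N. centering N l r *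
    (\<Sum>s=1..N. centering N m s * F p q r s)))"
  have add: "?S (\<lambda>p q r s. F p q r s + F' p q r s) = ?S F + ?S F'" for F F' :: "nat \<Rightarrow> nat \<Rightarrow> nat \<Rightarrow> nat \<Rightarrow> real"
    by (simp add: distrib_left sum.distrib)
  have mult: "?S (\<lambda>p q r s. x * F p q r s) = x * ?S F" for x and F :: "nat \<Rightarrow> nat \<Rightarrow> nat \<Rightarrow> nat \<Rightarrow> real"
    by (simp add: sum_distrib_left mult_ac)
  have z: "(\<Sum>p=1..N. centering N x p * y) = 0" if "x \<in> {1..N}" for x y
    using sum_centering[OF that] by (simp flip: sum_distrib_right)
  \<comment> \<open>\<open>Fp\<close>, \<open>Fq\<close>, \<open>Fr\<close>, \<open>Fs\<close> collect the monomials that leave the index \<open>p\<close>, \<open>q\<close>, \<open>r\<close>, \<open>s\<close> free.\<close>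
  define Fp where "Fp q r s = d * (1 - \<delta> r s) + (c - d) * (\<delta> q r + \<delta> q s - \<delta> q r * \<delta> r s - \<delta> q s * \<delta> r s)" for q r s
  define Fq where "Fq p r s = (c - d) * (\<delta> p r + \<delta> p s - \<delta> p r * \<delta> r s - \<delta> p s * \<delta> r s)" for p r s
  define Fr where "Fr p q s = (d - c) * (\<delta> p s * \<delta> p q + \<delta> q s * \<delta> p q)" for p q s
  define Fs where "Fs p q r = - d * \<delta> p q + (d - c) * (\<delta> p r * \<delta> p q + \<delta> q r * \<delta> p q)" for p q r
  \<comment> \<open>The coefficient of the triple delta has two sources. Each of the four terms with
    factor \<open>c - d\<close> contributes \<open>\<delta> p q * \<delta> r s\<close> times a
    linking delta, which means that all indices agree; and each of the two double deltas must lose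
    its value at \<open>p = q = r = s\<close>, where \<open>G\<close> vanishes.\<close>
  define U where "U p q r s = d * (\<delta> p q * \<delta> r s) + (4 * (c - d) - 2 * (b - 2 * c + d)) * (\<delta> p q * \<delta> p r * \<delta> p s)
      + (b - 2 * c + d) * (\<delta> p r * \<delta> q s + \<delta> p s * \<delta> q r)" for p q r s
  have "G p q r s = Fp q r s + Fq p r s + Fr p q s + Fs p q r + U p q r s" for p q r s
    unfolding G Fp_def Fq_def Fr_def Fs_def U_def
    by (cases "p = q"; cases "r = s"; cases "p = r"; cases "p = s"; cases "q = r"; cases "q = s") 
      (simp_all add: algebra_simps)
  then have "?S G = ?S (\<lambda>p q r s. Fp q r s) + ?S (\<lambda>p q r s. Fq p r s) + ?S (\<lambda>p q r s. Fr p q s)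
      + ?S (\<lambda>p q r s. Fs p q r) + ?S U"
    by (simp only: add)
  also have "?S (\<lambda>p q r s. Fp q r s) = 0" by (rule z) fact
  also have "?S (\<lambda>p q r s. Fq p r s) = 0" using z[OF assms(2)] by simp
  also have "?S (\<lambda>p q r s. Fr p q s) = 0" using z[OF assms(3)] by simp
  also have "?S (\<lambda>p q r s. Fs p q r) = 0" using z[OF assms(4)] by simp
  also have "?S U = d * ?S (\<lambda>p q r s. \<delta> p q * \<delta> r s)
      + (4 * (c - d) - 2 * (b - 2 * c + d)) * ?S (\<lambda>p q r s. \<delta> p q * \<delta> p r * \<delta> p s)
      + (b - 2 * c + d) * (?S (\<lambda>p q r s. \<delta> p r * \<delta> q s) + ?S (\<lambda>p q r s. \<delta> p s * \<delta> q r))"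
    unfolding U_def by (simp only: add mult)
  also have "?S (\<lambda>p q r s. \<delta> p q * \<delta> r s) = centering N j k * centering N l m"
  proof -
    define K where "K = (\<Sum>r=1..N. centering N l r * (\<Sum>s=1..N. centering N m s * \<delta> r s))"
    have "(\<Sum>r=1..N. centering N l r * (\<Sum>s=1..N. centering N m s * (\<delta> p q * \<delta> r s))) = \<delta> p q * K" for p q
      unfolding K_def by (simp only: sum_distrib_left mult_ac)
    then have "?S (\<lambda>p q r s. \<delta> p q * \<delta> r s)
        = (\<Sum>p=1..N. centering N j p * (\<Sum>q=1..N. centering N k q * \<delta> p q)) * K"
      by (simp only: sum_distrib_right mult.assoc)
    also have "\<dots> = (\<Sum>p=1..N. centering N j p * centering N k p) * (\<Sum>r=1..N. centering N l r * centering N m r)"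
      unfolding K_def
      by (intro arg_cong2[where f = "(*)"] sum.cong refl) (simp_all only: sum_mult_delta)
    finally show ?thesis using assms(1-4) by (simp only: sum_centering_mult)
  qed
  also have "?S (\<lambda>p q r s. \<delta> p r * \<delta> q s) = centering N j l * centering N k m"
  proof -
    have "?S (\<lambda>p q r s. \<delta> p r * \<delta> q s) = (\<Sum>p=1..N. centering N j p * (\<Sum>q=1..N. centering N k q *
        ((\<Sum>r=1..N. centering N l r * \<delta> p r) * (\<Sum>s=1..N. centering N m s * \<delta> q s))))"
      unfolding sum_product by (simp only: sum_distrib_left mult_ac)
    also have "\<dots> = (\<Sum>p=1..N. centering N j p * (\<Sum>q=1..N. centering N k q * (centering N l p * centering N m q)))"
      by (simp only: sum_mult_delta cong: sum.cong)
    also have "\<dots> = (\<Sum>p=1..N. centering N j p * centering N l p) * (\<Sum>q=1..N. centering N k q * centering N m q)"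
      unfolding sum_product by (simp only: sum_distrib_left mult_ac)
    finally show ?thesis using assms(1-4) by (simp only: sum_centering_mult)
  qed
  also have "?S (\<lambda>p q r s. \<delta> p s * \<delta> q r) = centering N j m * centering N k l"
  proof -
    have "?S (\<lambda>p q r s. \<delta> p s * \<delta> q r) = (\<Sum>p=1..N. centering N j p * (\<Sum>q=1..N. centering N k q *
        ((\<Sum>r=1..N. centering N l r * \<delta> q r) * (\<Sum>s=1..N. centering N m s * \<delta> p s))))"
      unfolding sum_product by (simp only: sum_distrib_left mult_ac)
    also have "\<dots> = (\<Sum>p=1..N. centering N j p * (\<Sum>q=1..N. centering N k q * (centering N l q * centering N m p)))"
      by (simp only: sum_mult_delta cong: sum.cong)
    also have "\<dots> = (\<Sum>p=1..N. centering N j p * centering N m p) * (\<Sum>q=1..N. centering N k q * centering N l q)"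
      unfolding sum_product by (simp only: sum_distrib_left mult_ac)
    finally show ?thesis using assms(1-4) by (simp only: sum_centering_mult)
  qed
  also have "?S (\<lambda>p q r s. \<delta> p q * \<delta> p r * \<delta> p s) = centering4 N j k l m"
  proof -
    have "?S (\<lambda>p q r s. \<delta> p q * \<delta> p r * \<delta> p s) = (\<Sum>p=1..N. centering N j p * ((\<Sum>q=1..N. centering N k q * \<delta> p q) *
        ((\<Sum>r=1..N. centering N l r * \<delta> p r) * (\<Sum>s=1..N. centering N m s * \<delta> p s))))"
      unfolding sum_product by (simp only: sum_distrib_left mult_ac)
    also have "\<dots> = (\<Sum>p=1..N. centering N j p * (centering N k p * (centering N l p * centering N m p)))"
      by (simp only: sum_mult_delta cong: sum.cong)
    finally show ?thesis by (simp only: centering4_def mult.assoc)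
  qed
  finally show ?thesis unfolding moment2_def by (simp add: algebra_simps)
qed

text \<open>The matrix is \<open>x (J - I)\<close> with \<open>J\<close> the all-ones matrix. From
  \<open>C J = 0\<close> and \<open>C^2 = C\<close> it follows that
  \<open>- C B C = x C\<close>.\<close>

lemma double_centered_off_diagonal:
  assumes "j \<in> {1..N}" "k \<in> {1..N}"
  shows "double_centered N (\<lambda>p q. x * (1 - \<delta> p q)) j k = x * centering N j k"
proof -
  have "(\<Sum>p=1..N. \<Sum>q=1..N. centering N j p * centering N k q * (x * (1 - \<delta> p q)))
      = x * ((\<Sum>p=1..N. centering N j p) * (\<Sum>q=1..N. centering N k q)
         - (\<Sum>p=1..N. centering N j p * (\<Sum>q=1..N. centering N k q * \<delta> p q)))"
    unfolding sum_product
    by (simp only: sum_distrib_left sum_subtractf right_diff_distrib mult_1_left mult_1_right mult_ac)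
  also have "\<dots> = x * (0 - centering N j k)"
    using assms by (simp only: sum_centering sum_mult_delta sum_centering_mult mult_zero_left cong: sum.cong)
  finally show ?thesis by (simp add: double_centered_def)
qed

subsection \<open>Moments of a doubly centered kernel matrix\<close>

context prob_space
begin

text \<open>Distinct members of an i.i.d. family have a power of \<open>P\<close> as joint law,
  whichever members are chosen. Injectivity of \<open>t\<close> ensures that they are distinct, so
  that the coordinates of the product measure can be renamed along \<open>t\<close>.\<close>

lemma iid_distr_reindex:
  assumes Y: "indep_vars (\<lambda>_. S) Y I" and P: "\<And>k. k \<in> I \<Longrightarrow> distr M S (Y k) = P"
    and t: "inj_on t J" "t ` J \<subseteq> I" and fin: "finite J" "J \<noteq> {}"
  shows "distr M (\<Pi>\<^sub>M j\<in>J. S) (\<lambda>\<omega>. \<lambda>j\<in>J. Y (t j) \<omega>) = (\<Pi>\<^sub>M j\<in>J. P)"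
proof -
  have rv: "random_variable S (Y k)" if "k \<in> I" for k
    using Y that by (auto simp: indep_vars_def)
  obtain i where i: "i \<in> I" using fin t by auto
  have PP: "prob_space P" using P[OF i] rv[OF i] by (metis prob_space_distr)
  have sP: "sets P = sets S" using P[OF i] by (metis sets_distr)
  interpret Q: product_prob_space "\<lambda>_. P" by (rule product_prob_spaceI) (rule PP)
  let ?K = "t ` J"
  have K: "indep_vars (\<lambda>_. S) Y ?K" using Y t(2) by (rule indep_vars_subset)
  have "distr M (\<Pi>\<^sub>M k\<in>?K. S) (\<lambda>\<omega>. \<lambda>k\<in>?K. Y k \<omega>) = (\<Pi>\<^sub>M k\<in>?K. distr M S (Y k))"
    using K fin t rv by (subst indep_vars_iff_distr_eq_PiM'[symmetric]) auto
  also have "\<dots> = (\<Pi>\<^sub>M k\<in>?K. P)" using t P by (intro PiM_cong) auto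
  finally have D: "distr M (\<Pi>\<^sub>M k\<in>?K. S) (\<lambda>\<omega>. \<lambda>k\<in>?K. Y k \<omega>) = (\<Pi>\<^sub>M k\<in>?K. P)" .
  have "(\<Pi>\<^sub>M j\<in>J. P) = distr (\<Pi>\<^sub>M k\<in>?K. P) (\<Pi>\<^sub>M j\<in>J. P) (\<lambda>\<omega>. \<lambda>j\<in>J. \<omega> (t j))"
    using t fin by (intro Q.distr_reorder[symmetric]) auto
  also have "\<dots> = distr (\<Pi>\<^sub>M k\<in>?K. P) (\<Pi>\<^sub>M j\<in>J. S) (\<lambda>\<omega>. \<lambda>j\<in>J. \<omega> (t j))"
    using sP by (intro distr_cong sets_PiM_cong) auto
  also have "\<dots> = distr M (\<Pi>\<^sub>M j\<in>J. S) ((\<lambda>\<omega>. \<lambda>j\<in>J. \<omega> (t j)) \<circ> (\<lambda>\<omega>. \<lambda>k\<in>?K. Y k \<omega>))"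
    unfolding D[symmetric] using rv t
    by (intro distr_distr measurable_restrict measurable_component_singleton) auto
  also have "\<dots> = distr M (\<Pi>\<^sub>M j\<in>J. S) (\<lambda>\<omega>. \<lambda>j\<in>J. Y (t j) \<omega>)"
    by (intro arg_cong[where f = "distr _ _"]) (auto simp: fun_eq_iff)
  finally show ?thesis ..
qed

end

text \<open>One coordinate in abstract form: \<open>Y\<close> is the sample, \<open>Z\<close> the
  triple of copies that defines the moments, \<open>\<phi> x y\<close> stands for
  \<open>\<psi>(x - y)\<close> and \<open>h\<close> for \<open>\<psi>\<close>. The bound
  \<open>kernel_le\<close> and the square integrability of \<open>h\<close> make all second moments
  of the kernel finite.\<close>

locale iid_kernel = prob_space M for M :: "'w measure" +
  fixes S :: "'s measure" and Y Z :: "nat \<Rightarrow> 'w \<Rightarrow> 's" and N :: nat and P :: "'s measure"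
    and \<phi> :: "'s \<Rightarrow> 's \<Rightarrow> real" and h :: "'s \<Rightarrow> real"
  assumes Y: "indep_vars (\<lambda>_. S) Y {1..N}" "\<And>k. k \<in> {1..N} \<Longrightarrow> distr M S (Y k) = P"
    and Z: "indep_vars (\<lambda>_. S) Z {0, 1, 2}" "\<And>k. k \<in> {0, 1, 2} \<Longrightarrow> distr M S (Z k) = P"
    and measurable_kernel [measurable]: "(\<lambda>(x, y). \<phi> x y) \<in> borel_measurable (S \<Otimes>\<^sub>M S)"
    and kernel_self [simp]: "\<And>x. \<phi> x x = 0"
    and kernel_commute: "\<And>x y. \<phi> x y = \<phi> y x"
    and h [measurable]: "h \<in> borel_measurable S"
    and kernel_le: "\<And>x y. \<bar>\<phi> x y\<bar> \<le> 2 * h x + 2 * h y"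
    and integrable_h: "integrable M (\<lambda>\<omega>. (h (Z 0 \<omega>))\<^sup>2)"
begin

lemma Y_measurable: "k \<in> {1..N} \<Longrightarrow> Y k \<in> M \<rightarrow>\<^sub>M S"
  using Y(1) by (auto simp: indep_vars_def)

lemma Z_measurable: "k \<in> {0, 1, 2} \<Longrightarrow> Z k \<in> M \<rightarrow>\<^sub>M S"
  using Z(1) by (auto simp: indep_vars_def)

text \<open>Both tuples have the same power of \<open>P\<close> as their law. Moments of the sample
  can thus be read off from the copies \<open>Z\<close>.\<close>

lemma expectation_reindex:
  fixes f :: "(nat \<Rightarrow> 's) \<Rightarrow> real"
  assumes t: "inj_on t J" "t ` J \<subseteq> {1..N}" and J: "J \<subseteq> {0, 1, 2}" "J \<noteq> {}"
    and f: "f \<in> borel_measurable (\<Pi>\<^sub>M j\<in>J. S)"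
  shows "expectation (\<lambda>\<omega>. f (\<lambda>j\<in>J. Y (t j) \<omega>)) = expectation (\<lambda>\<omega>. f (\<lambda>j\<in>J. Z j \<omega>))"
proof -
  have fin: "finite J" using J by (auto intro: finite_subset)
  have "expectation (\<lambda>\<omega>. f (\<lambda>j\<in>J. Y (t j) \<omega>))
      = integral\<^sup>L (distr M (\<Pi>\<^sub>M j\<in>J. S) (\<lambda>\<omega>. \<lambda>j\<in>J. Y (t j) \<omega>)) f"
    using t Y_measurable by (intro integral_distr[symmetric] f measurable_restrict) auto
  also have "\<dots> = integral\<^sup>L (distr M (\<Pi>\<^sub>M j\<in>J. S) (\<lambda>\<omega>. \<lambda>j\<in>J. Z j \<omega>)) f"
    using iid_distr_reindex[OF Y t fin J(2)] iid_distr_reindex[OF Z, of id J] fin J by simp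
  also have "\<dots> = expectation (\<lambda>\<omega>. f (\<lambda>j\<in>J. Z j \<omega>))"
    using J Z_measurable by (intro integral_distr f measurable_restrict) auto
  finally show ?thesis .
qed

definition "\<mu> = expectation (\<lambda>\<omega>. \<phi> (Z 0 \<omega>) (Z 1 \<omega>))"
definition "\<beta> = expectation (\<lambda>\<omega>. (\<phi> (Z 0 \<omega>) (Z 1 \<omega>))\<^sup>2)"
definition "\<gamma> = expectation (\<lambda>\<omega>. \<phi> (Z 0 \<omega>) (Z 1 \<omega>) * \<phi> (Z 1 \<omega>) (Z 2 \<omega>))"

lemma kernel_random_variable:
  "p \<in> {1..N} \<Longrightarrow> q \<in> {1..N} \<Longrightarrow> random_variable borel (\<lambda>\<omega>. \<phi> (Y p \<omega>) (Y q \<omega>))"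
  using measurable_compose[OF measurable_Pair[OF Y_measurable Y_measurable] measurable_kernel] by simp

lemma integrable_kernel_square:
  assumes "p \<in> {1..N}" "q \<in> {1..N}"
  shows "integrable M (\<lambda>\<omega>. (\<phi> (Y p \<omega>) (Y q \<omega>))\<^sup>2)"
proof (rule Bochner_Integration.integrable_bound)
  have "integrable M (\<lambda>\<omega>. (h (Y k \<omega>))\<^sup>2)" if "k \<in> {1..N}" for k
  proof -
    have "integrable (distr M S (Z 0)) (\<lambda>x. (h x)\<^sup>2)"
      using integrable_h Z_measurable by (subst integrable_distr_eq) auto
    then have "integrable (distr M S (Y k)) (\<lambda>x. (h x)\<^sup>2)" using Y(2)[OF that] Z(2)[of 0] by simp
    then show ?thesis using Y_measurable[OF that] by (subst (asm) integrable_distr_eq) auto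
  qed
  then show "integrable M (\<lambda>\<omega>. 8 * (h (Y p \<omega>))\<^sup>2 + 8 * (h (Y q \<omega>))\<^sup>2)" using assms by auto
  show "random_variable borel (\<lambda>\<omega>. (\<phi> (Y p \<omega>) (Y q \<omega>))\<^sup>2)"
    using kernel_random_variable[OF assms] by simp
  show "AE \<omega> in M. norm ((\<phi> (Y p \<omega>) (Y q \<omega>))\<^sup>2) \<le> norm (8 * (h (Y p \<omega>))\<^sup>2 + 8 * (h (Y q \<omega>))\<^sup>2)"
  proof (rule AE_I2)
    fix \<omega>
    let ?x = "h (Y p \<omega>)" and ?y = "h (Y q \<omega>)"
    have "(\<phi> (Y p \<omega>) (Y q \<omega>))\<^sup>2 \<le> (2 * ?x + 2 * ?y)\<^sup>2"
      by (rule power2_le_iff_abs_le[THEN iffD2]) (use kernel_le[of "Y p \<omega>" "Y q \<omega>"] in auto)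
    also have "\<dots> \<le> 8 * ?x\<^sup>2 + 8 * ?y\<^sup>2"
      using zero_le_power2[of "?x - ?y"] by (simp add: power2_eq_square algebra_simps)
    finally show "norm ((\<phi> (Y p \<omega>) (Y q \<omega>))\<^sup>2) \<le> norm (8 * ?x\<^sup>2 + 8 * ?y\<^sup>2)" by simp
  qed
qed

lemma integrable_kernel_mult:
  assumes "p \<in> {1..N}" "q \<in> {1..N}" "r \<in> {1..N}" "s \<in> {1..N}"
  shows "integrable M (\<lambda>\<omega>. \<phi> (Y p \<omega>) (Y q \<omega>) * \<phi> (Y r \<omega>) (Y s \<omega>))"
proof (rule Bochner_Integration.integrable_bound)
  show "integrable M (\<lambda>\<omega>. (\<phi> (Y p \<omega>) (Y q \<omega>))\<^sup>2 + (\<phi> (Y r \<omega>) (Y s \<omega>))\<^sup>2)"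
    using assms by (intro Bochner_Integration.integrable_add integrable_kernel_square)
  show "random_variable borel (\<lambda>\<omega>. \<phi> (Y p \<omega>) (Y q \<omega>) * \<phi> (Y r \<omega>) (Y s \<omega>))"
    using assms by (intro borel_measurable_times kernel_random_variable)
  show "AE \<omega> in M. norm (\<phi> (Y p \<omega>) (Y q \<omega>) * \<phi> (Y r \<omega>) (Y s \<omega>))
      \<le> norm ((\<phi> (Y p \<omega>) (Y q \<omega>))\<^sup>2 + (\<phi> (Y r \<omega>) (Y s \<omega>))\<^sup>2)"
  proof (rule AE_I2)
    fix \<omega>
    let ?a = "\<bar>\<phi> (Y p \<omega>) (Y q \<omega>)\<bar>" and ?b = "\<bar>\<phi> (Y r \<omega>) (Y s \<omega>)\<bar>"
    have "0 \<le> ?a * ?b" by simp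
    with sum_squares_bound[of ?a ?b] have "?a * ?b \<le> ?a\<^sup>2 + ?b\<^sup>2" by linarith
    then show "norm (\<phi> (Y p \<omega>) (Y q \<omega>) * \<phi> (Y r \<omega>) (Y s \<omega>))
        \<le> norm ((\<phi> (Y p \<omega>) (Y q \<omega>))\<^sup>2 + (\<phi> (Y r \<omega>) (Y s \<omega>))\<^sup>2)"
      by (simp add: abs_mult)
  qed
qed

lemma integrable_kernel:
  assumes "p \<in> {1..N}" "q \<in> {1..N}"
  shows "integrable M (\<lambda>\<omega>. \<phi> (Y p \<omega>) (Y q \<omega>))"
  using square_integrable_imp_integrable[OF kernel_random_variable integrable_kernel_square] assms by simp

lemma kernel_pair:
  assumes "p \<in> {1..N}" "q \<in> {1..N}" "p \<noteq> q"
  shows "expectation (\<lambda>\<omega>. \<phi> (Y p \<omega>) (Y q \<omega>)) = \<mu>"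
    and "expectation (\<lambda>\<omega>. (\<phi> (Y p \<omega>) (Y q \<omega>))\<^sup>2) = \<beta>"
proof -
  let ?t = "\<lambda>i::nat. if i = 0 then p else q"
  have m: "(\<lambda>x. \<phi> (x 0) (x 1)) \<in> borel_measurable (\<Pi>\<^sub>M j\<in>{0, 1::nat}. S)"
    by measurable
  show "expectation (\<lambda>\<omega>. \<phi> (Y p \<omega>) (Y q \<omega>)) = \<mu>"
    using expectation_reindex[of ?t "{0, 1}" "\<lambda>x. \<phi> (x 0) (x 1)"] assms m by (simp add: \<mu>_def)
  show "expectation (\<lambda>\<omega>. (\<phi> (Y p \<omega>) (Y q \<omega>))\<^sup>2) = \<beta>"
    using expectation_reindex[of ?t "{0, 1}" "\<lambda>x. (\<phi> (x 0) (x 1))\<^sup>2"] assms m by (simp add: \<beta>_def)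
qed

lemma kernel_triple:
  assumes "p \<in> {1..N}" "q \<in> {1..N}" "r \<in> {1..N}" "p \<noteq> q" "q \<noteq> r" "p \<noteq> r"
  shows "expectation (\<lambda>\<omega>. \<phi> (Y p \<omega>) (Y q \<omega>) * \<phi> (Y q \<omega>) (Y r \<omega>)) = \<gamma>"
proof -
  let ?t = "\<lambda>i::nat. if i = 0 then p else if i = 1 then q else r"
  have m: "(\<lambda>x. \<phi> (x 0) (x 1) * \<phi> (x 1) (x 2)) \<in> borel_measurable (\<Pi>\<^sub>M j\<in>{0, 1, 2::nat}. S)"
    by measurable
  show ?thesis
    using expectation_reindex[of ?t "{0, 1, 2}", OF _ _ _ _ m] assms by (simp add: \<gamma>_def inj_on_def)
qed

text \<open>Pairs over disjoint index sets are independent, so the expectation factors. Hence three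
  copies in \<open>Z\<close> are enough to express all second moments.\<close>

lemma kernel_quadruple:
  assumes "p \<in> {1..N}" "q \<in> {1..N}" "r \<in> {1..N}" "s \<in> {1..N}" "p \<noteq> q" "r \<noteq> s" "{p, q} \<inter> {r, s} = {}"
  shows "expectation (\<lambda>\<omega>. \<phi> (Y p \<omega>) (Y q \<omega>) * \<phi> (Y r \<omega>) (Y s \<omega>)) = \<mu>\<^sup>2"
proof -
  have m: "(\<lambda>x. \<phi> (x u) (x v)) \<in> borel_measurable (\<Pi>\<^sub>M j\<in>{u, v::nat}. S)" for u v
    by measurable
  have "indep_var (PiM {p, q} (\<lambda>_. S)) (\<lambda>\<omega>. \<lambda>i\<in>{p, q}. Y i \<omega>) (PiM {r, s} (\<lambda>_. S)) (\<lambda>\<omega>. \<lambda>i\<in>{r, s}. Y i \<omega>)"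
    using assms by (intro indep_var_restrict[OF Y(1)]) auto
  from indep_var_compose[OF this m m]
  have "indep_var borel (\<lambda>\<omega>. \<phi> (Y p \<omega>) (Y q \<omega>)) borel (\<lambda>\<omega>. \<phi> (Y r \<omega>) (Y s \<omega>))"
    by (simp add: comp_def)
  then show ?thesis
    using assms by (simp add: indep_var_lebesgue_integral integrable_kernel kernel_pair power2_eq_square)
qed

lemma expectation_kernel:
  assumes "p \<in> {1..N}" "q \<in> {1..N}"
  shows "expectation (\<lambda>\<omega>. \<phi> (Y p \<omega>) (Y q \<omega>)) = \<mu> * (1 - \<delta> p q)"
  using kernel_pair(1)[OF assms] by (cases "p = q") auto

text \<open>The polynomial interpolates the possible values: 0 if a pair is degenerate, otherwise
  \<open>\<mu>\<^sup>2\<close>, \<open>\<gamma>\<close> or \<open>\<beta>\<close> if the pairs share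
  no, one or two indices. With two shared indices the linear part counts twice, and the last term
  corrects \<open>2 * \<gamma> - \<mu>\<^sup>2\<close> to \<open>\<beta>\<close>.\<close>

lemma expectation_kernel_mult:
  assumes "p \<in> {1..N}" "q \<in> {1..N}" "r \<in> {1..N}" "s \<in> {1..N}"
  shows "expectation (\<lambda>\<omega>. \<phi> (Y p \<omega>) (Y q \<omega>) * \<phi> (Y r \<omega>) (Y s \<omega>))
    = (1 - \<delta> p q) * (1 - \<delta> r s) * (\<mu>\<^sup>2 + (\<gamma> - \<mu>\<^sup>2) * (\<delta> p r + \<delta> p s + \<delta> q r + \<delta> q s)
      + (\<beta> - 2 * \<gamma> + \<mu>\<^sup>2) * (\<delta> p r * \<delta> q s + \<delta> p s * \<delta> q r))"
    (is "?E p q r s = _")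
proof -
  consider "p = q \<or> r = s" | "p \<noteq> q" "r \<noteq> s" "{p, q} \<inter> {r, s} = {}"
    | "p \<noteq> q" "r = p" "s = q" | "p \<noteq> q" "r = q" "s = p"
    | "p \<noteq> q" "r = p" "s \<noteq> p" "s \<noteq> q" | "p \<noteq> q" "r = q" "s \<noteq> p" "s \<noteq> q"
    | "p \<noteq> q" "s = p" "r \<noteq> p" "r \<noteq> q" | "p \<noteq> q" "s = q" "r \<noteq> p" "r \<noteq> q"
    by blast
  then show ?thesis
  proof cases
    case 1 then show ?thesis by auto
  next
    case 2 then show ?thesis using kernel_quadruple[OF assms] by auto
  next
    case 3 then show ?thesis using kernel_pair(2)[of p q] assms by (simp add: power2_eq_square)
  next
    case 4 then show ?thesis
      using kernel_pair(2)[of p q] assms by (simp add: power2_eq_square kernel_commute[of "Y q _" "Y p _"])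
  next
    case 5 then show ?thesis
      using kernel_triple[of q p s] assms by (simp add: kernel_commute[of "Y q _" "Y p _"])
  next
    case 6 then show ?thesis using kernel_triple[of p q s] assms by simp
  next
    case 7 then show ?thesis
      using kernel_triple[of q p r] assms
      by (simp add: kernel_commute[of "Y q _" "Y p _"] kernel_commute[of "Y r _" "Y p _"])
  next
    case 8 then show ?thesis
      using kernel_triple[of p q r] assms by (simp add: kernel_commute[of "Y r _" "Y q _"])
  qed
qed

definition "centered_kernel j k \<omega> = double_centered N (\<lambda>p q. \<phi> (Y p \<omega>) (Y q \<omega>)) j k"

text \<open>\<open>has_bochner_integral\<close> yields integrability and value in one application of
  linearity. The indices \<open>j\<close> and \<open>k\<close> may be arbitrary, as only the
  summation indices select sample points.\<close>

lemma has_bochner_integral_centered_kernel: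
  "has_bochner_integral M (centered_kernel j k) (double_centered N (\<lambda>p q. expectation (\<lambda>\<omega>. \<phi> (Y p \<omega>) (Y q \<omega>))) j k)"
  unfolding centered_kernel_def[abs_def] double_centered_def
  by (intro has_bochner_integral_minus has_bochner_integral_sum has_bochner_integral_mult_right
      has_bochner_integral_integrable integrable_kernel)

lemma integrable_centered_kernel: "integrable M (centered_kernel j k)"
  using has_bochner_integral_centered_kernel by (rule integrable.intros)

lemma expectation_centered_kernel:
  assumes "j \<in> {1..N}" "k \<in> {1..N}"
  shows "expectation (centered_kernel j k) = \<mu> * centering N j k"
proof -
  have "expectation (centered_kernel j k) = double_centered N (\<lambda>p q. expectation (\<lambda>\<omega>. \<phi> (Y p \<omega>) (Y q \<omega>))) j k"
    using has_bochner_integral_centered_kernel by (rule has_bochner_integral_integral_eq)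
  also have "\<dots> = double_centered N (\<lambda>p q. \<mu> * (1 - \<delta> p q)) j k"
    unfolding double_centered_def using expectation_kernel by (intro arg_cong[where f = uminus] sum.cong refl) simp
  finally show ?thesis using double_centered_off_diagonal[OF assms] by simp
qed

lemma centered_kernel_mult:
  "centered_kernel j k \<omega> * centered_kernel l m \<omega> = (\<Sum>p=1..N. \<Sum>q=1..N. \<Sum>r=1..N. \<Sum>s=1..N.
     (centering N j p * centering N k q * centering N l r * centering N m s)
     * (\<phi> (Y p \<omega>) (Y q \<omega>) * \<phi> (Y r \<omega>) (Y s \<omega>)))"
  unfolding centered_kernel_def double_centered_def minus_mult_minus sum2_mult_sum2
  by (intro sum.cong refl) simp

lemma has_bochner_integral_centered_kernel_mult:
  "has_bochner_integral M (\<lambda>\<omega>. centered_kernel j k \<omega> * centered_kernel l m \<omega>) (\<Sum>p=1..N. \<Sum>q=1..N. \<Sum>r=1..N. \<Sum>s=1..N.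
     (centering N j p * centering N k q * centering N l r * centering N m s)
     * expectation (\<lambda>\<omega>. \<phi> (Y p \<omega>) (Y q \<omega>) * \<phi> (Y r \<omega>) (Y s \<omega>)))"
  unfolding centered_kernel_mult
  by (intro has_bochner_integral_sum has_bochner_integral_mult_right
      has_bochner_integral_integrable integrable_kernel_mult)

lemma integrable_centered_kernel_mult: "integrable M (\<lambda>\<omega>. centered_kernel j k \<omega> * centered_kernel l m \<omega>)"
  using has_bochner_integral_centered_kernel_mult by (rule integrable.intros)

lemma expectation_centered_kernel_mult:
  assumes "j \<in> {1..N}" "k \<in> {1..N}" "l \<in> {1..N}" "m \<in> {1..N}"
  shows "expectation (\<lambda>\<omega>. centered_kernel j k \<omega> * centered_kernel l m \<omega>) = moment2 N \<beta> \<gamma> (\<mu>\<^sup>2) j k l m"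
proof -
  have "expectation (\<lambda>\<omega>. centered_kernel j k \<omega> * centered_kernel l m \<omega>) = (\<Sum>p=1..N. \<Sum>q=1..N. \<Sum>r=1..N. \<Sum>s=1..N.
     (centering N j p * centering N k q * centering N l r * centering N m s)
     * expectation (\<lambda>\<omega>. \<phi> (Y p \<omega>) (Y q \<omega>) * \<phi> (Y r \<omega>) (Y s \<omega>)))"
    using has_bochner_integral_centered_kernel_mult by (rule has_bochner_integral_integral_eq)
  also have "\<dots> = (\<Sum>p=1..N. \<Sum>q=1..N. \<Sum>r=1..N. \<Sum>s=1..N.
     (centering N j p * centering N k q * centering N l r * centering N m s)
     * ((1 - \<delta> p q) * (1 - \<delta> r s) * (\<mu>\<^sup>2 + (\<gamma> - \<mu>\<^sup>2) * (\<delta> p r + \<delta> p s + \<delta> q r + \<delta> q s)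
      + (\<beta> - 2 * \<gamma> + \<mu>\<^sup>2) * (\<delta> p r * \<delta> q s + \<delta> p s * \<delta> q r))))"
    by (intro sum.cong refl arg_cong2[where f = "(*)"] expectation_kernel_mult)
  also have "\<dots> = moment2 N \<beta> \<gamma> (\<mu>\<^sup>2) j k l m"
    by (subst sum_centering_pair_moments[OF assms refl, symmetric]) (simp only: sum_distrib_left mult.assoc)
  finally show ?thesis .
qed

end

section \<open>Joint independence of all coordinates of all observations\<close>

text \<open>Independence of the observations factors the probability of a box over \<open>l\<close>.
  Each observation has the joint law of the independent \<open>X i\<close>, which factors the
  remaining probabilities over \<open>i\<close>.\<close>

lemma (in prob_space) indep_vars_components:
  assumes XS: "indep_vars (\<lambda>_. PiM I S) XS L" and X: "indep_vars S X I"
    and fin: "finite I" "I \<noteq> {}" "finite L" "L \<noteq> {}"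
    and law: "\<And>l. l \<in> L \<Longrightarrow> distr M (PiM I S) (XS l) = distr M (PiM I S) (\<lambda>\<omega>. \<lambda>i\<in>I. X i \<omega>)"
  shows "indep_vars (\<lambda>p. S (snd p)) (\<lambda>p \<omega>. XS (fst p) \<omega> (snd p)) (L \<times> I)"
    and "l \<in> L \<Longrightarrow> i \<in> I \<Longrightarrow> distr M (S i) (\<lambda>\<omega>. XS l \<omega> i) = distr M (S i) (X i)"
proof -
  have rXS: "random_variable (PiM I S) (XS l)" if "l \<in> L" for l
    using XS that by (auto simp: indep_vars_def)
  have rX: "random_variable (S i) (X i)" if "i \<in> I" for i
    using X that by (auto simp: indep_vars_def)
  then have rR: "random_variable (PiM I S) (\<lambda>\<omega>. \<lambda>i\<in>I. X i \<omega>)" by (rule measurable_restrict)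
  have comp: "random_variable (S i) (\<lambda>\<omega>. XS l \<omega> i)" if "l \<in> L" "i \<in> I" for l i
    using rXS[OF that(1)] that(2) by (rule measurable_compose[OF _ measurable_component_singleton])
  show dc: "distr M (S i) (\<lambda>\<omega>. XS l \<omega> i) = distr M (S i) (X i)" if l: "l \<in> L" and i: "i \<in> I" for l i
  proof -
    have "distr M (S i) (\<lambda>\<omega>. XS l \<omega> i) = distr (distr M (PiM I S) (XS l)) (S i) (\<lambda>x. x i)"
      using rXS[OF l] i by (subst distr_distr) (auto simp: comp_def)
    also have "\<dots> = distr M (S i) (X i)"
      unfolding law[OF l] using rR i by (subst distr_distr) (auto simp: comp_def)
    finally show ?thesis .
  qed
  have box: "prob (XS l -` (Pi\<^sub>E I B) \<inter> space M) = (\<Prod>i\<in>I. prob ((\<lambda>\<omega>. XS l \<omega> i) -` B i \<inter> space M))"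
    if l: "l \<in> L" and B: "\<And>i. i \<in> I \<Longrightarrow> B i \<in> sets (S i)" for l B
  proof -
    have PB: "Pi\<^sub>E I B \<in> sets (PiM I S)" using fin B by (intro sets_PiM_I_finite) auto
    have "prob (XS l -` (Pi\<^sub>E I B) \<inter> space M) = measure (distr M (PiM I S) (XS l)) (Pi\<^sub>E I B)"
      using rXS[OF l] PB by (simp add: measure_distr)
    also have "\<dots> = prob ((\<lambda>\<omega>. \<lambda>i\<in>I. X i \<omega>) -` Pi\<^sub>E I B \<inter> space M)"
      unfolding law[OF l] using rR PB by (simp add: measure_distr)
    also have "(\<lambda>\<omega>. \<lambda>i\<in>I. X i \<omega>) -` Pi\<^sub>E I B \<inter> space M = (\<Inter>i\<in>I. X i -` B i \<inter> space M)"
      using fin(2) by (auto simp: PiE_iff)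
    also have "prob \<dots> = (\<Prod>i\<in>I. prob (X i -` B i \<inter> space M))"
      using X fin B by (intro indep_varsD_finite) auto
    also have "\<dots> = (\<Prod>i\<in>I. measure (distr M (S i) (X i)) (B i))"
      using rX B by (intro prod.cong refl) (simp add: measure_distr)
    also have "\<dots> = (\<Prod>i\<in>I. measure (distr M (S i) (\<lambda>\<omega>. XS l \<omega> i)) (B i))"
      using dc[OF l] by simp
    also have "\<dots> = (\<Prod>i\<in>I. prob ((\<lambda>\<omega>. XS l \<omega> i) -` B i \<inter> space M))"
      using comp[OF l] B by (intro prod.cong refl) (simp add: measure_distr)
    finally show ?thesis .
  qed
  show "indep_vars (\<lambda>p. S (snd p)) (\<lambda>p \<omega>. XS (fst p) \<omega> (snd p)) (L \<times> I)"
  proof (subst indep_vars_finite[where E = "\<lambda>p. sets (S (snd p))"])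
    show "\<forall>A\<in>\<Pi> p\<in>L \<times> I. sets (S (snd p)).
        prob (\<Inter>p\<in>L \<times> I. (\<lambda>\<omega>. XS (fst p) \<omega> (snd p)) -` A p \<inter> space M) =
        (\<Prod>p\<in>L \<times> I. prob ((\<lambda>\<omega>. XS (fst p) \<omega> (snd p)) -` A p \<inter> space M))"
    proof
      fix A assume "A \<in> (\<Pi> p\<in>L \<times> I. sets (S (snd p)))"
      then have A: "A (l, i) \<in> sets (S i)" if "l \<in> L" "i \<in> I" for l i
        using that by (auto simp: Pi_iff)
      have "(\<Inter>p\<in>L \<times> I. (\<lambda>\<omega>. XS (fst p) \<omega> (snd p)) -` A p \<inter> space M)
          = (\<Inter>l\<in>L. XS l -` (\<Pi>\<^sub>E i\<in>I. A (l, i)) \<inter> space M)"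
      proof -
        \<comment> \<open>Membership in \<open>Pi\<^sub>E\<close> also demands the value
          \<open>undefined\<close> outside \<open>I\<close>; values in the product space satisfy
          this.\<close>
        have "XS l \<omega> \<in> extensional I" if "l \<in> L" "\<omega> \<in> space M" for l \<omega>
          using measurable_space[OF rXS[OF that(1)] that(2)] by (simp add: space_PiM PiE_iff)
        then show ?thesis using fin(2) by (auto simp: PiE_iff)
      qed
      also have "prob \<dots> = (\<Prod>l\<in>L. prob (XS l -` (\<Pi>\<^sub>E i\<in>I. A (l, i)) \<inter> space M))"
        using XS fin A by (intro indep_varsD_finite) (auto intro!: sets_PiM_I_finite)
      also have "\<dots> = (\<Prod>l\<in>L. \<Prod>i\<in>I. prob ((\<lambda>\<omega>. XS l \<omega> i) -` A (l, i) \<inter> space M))"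
        using A by (intro prod.cong refl box) auto
      finally show "prob (\<Inter>p\<in>L \<times> I. (\<lambda>\<omega>. XS (fst p) \<omega> (snd p)) -` A p \<inter> space M) =
          (\<Prod>p\<in>L \<times> I. prob ((\<lambda>\<omega>. XS (fst p) \<omega> (snd p)) -` A p \<inter> space M))"
        by (simp add: prod.cartesian_product case_prod_unfold)
    qed
  qed (use fin comp in \<open>auto simp: sets.sigma_sets_eq sets.Int_stable sets.space_closed\<close>)
qed

text \<open>Every row of \<open>C\<close> consists of one entry \<open>1 - 1/N\<close> and
  \<open>N - 1\<close> entries \<open>-1/N\<close>.\<close>

lemma sum_power_centering:
  assumes "N \<ge> 1"
  shows "(\<Sum>j=1..N. \<Sum>k=1..N. centering N j k ^ n)
    = real N * ((1 - 1 / real N) ^ n + (real N - 1) * (- 1 / real N) ^ n)"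
proof -
  have "(\<Sum>k=1..N. centering N j k ^ n) = (1 - 1 / real N) ^ n + (real N - 1) * (- 1 / real N) ^ n"
    if "j \<in> {1..N}" for j
    using that sum_constant_off[of "{j}" N "\<lambda>k. centering N j k ^ n" "(- 1 / real N) ^ n"]
    by (auto simp: centering_def)
  then show ?thesis by simp
qed

text \<open>Integrability is asserted along with the two expectations, since the Bochner integral of
  a non-integrable function is 0 by convention and the equations alone would not show that the
  moments exist.\<close>

theorem theorem4p15:
  fixes M :: "'w measure"
    and n N :: nat
    and d :: "nat \<Rightarrow> nat"
    and \<rho> :: "nat \<Rightarrow> (nat \<Rightarrow> real) measure"
    and X X' X'' :: "nat \<Rightarrow> 'w \<Rightarrow> nat \<Rightarrow> real"
    and XS :: "nat \<Rightarrow> 'w \<Rightarrow> nat \<Rightarrow> nat \<Rightarrow> real"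
  defines "\<psi> \<equiv> \<lambda>i. psi (d i) (\<rho> i)"
    and "T \<equiv> \<lambda>\<omega>. real N * (sample_multivariance n d \<rho> N (\<lambda>l. XS l \<omega>))\<^sup>2"
  defines "\<mu> \<equiv> \<lambda>i. \<integral>\<omega>. \<psi> i (vdiff (d i) (X i \<omega>) (X' i \<omega>)) \<partial>M"
    and "b \<equiv> \<lambda>i. \<integral>\<omega>. (\<psi> i (vdiff (d i) (X i \<omega>) (X' i \<omega>)))\<^sup>2 \<partial>M"
    and "c \<equiv> \<lambda>i. \<integral>\<omega>. \<psi> i (vdiff (d i) (X i \<omega>) (X' i \<omega>))
                      * \<psi> i (vdiff (d i) (X' i \<omega>) (X'' i \<omega>)) \<partial>M"
    and "dd \<equiv> \<lambda>i. (\<integral>\<omega>. \<psi> i (vdiff (d i) (X i \<omega>) (X' i \<omega>)) \<partial>M)\<^sup>2"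
  assumes "prob_space M"
    and "n \<ge> 1" and "N \<ge> 1"
    and "\<And>i. i \<in> {1..n} \<Longrightarrow> admissible_measure (d i) (\<rho> i)"
    and "prob_space.indep_vars M (\<lambda>i. Rd (d i)) X {1..n}"
    and "\<And>i. i \<in> {1..n} \<Longrightarrow> integrable M (\<lambda>\<omega>. (\<psi> i (X i \<omega>))\<^sup>2)"
    and "\<And>i. i \<in> {1..n} \<Longrightarrow>
           indep_copies M (Rd (d i)) (\<lambda>k. [X i, X' i, X'' i] ! k) {0,1,2} (X i)"
    and "indep_copies M (\<Pi>\<^sub>M i\<in>{1..n}. Rd (d i)) XS {1..N} (\<lambda>\<omega>. \<lambda>i\<in>{1..n}. X i \<omega>)"
  shows "integrable M T \<and>
         (\<integral>\<omega>. T \<omega> \<partial>M)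
           = ((real N - 1) ^ n + (- 1) ^ n * (real N - 1)) / real N ^ n * (\<Prod>i=1..n. \<mu> i) \<and>
         ((real N - 1) ^ n + (- 1) ^ n * (real N - 1)) / real N ^ n * (\<Prod>i=1..n. \<mu> i)
           = (\<Prod>i=1..n. (1 - 1 / real N) * \<mu> i) + (real N - 1) * (\<Prod>i=1..n. (- 1 / real N) * \<mu> i) \<and>
         integrable M (\<lambda>\<omega>. (T \<omega>)\<^sup>2) \<and>
         (\<integral>\<omega>. (T \<omega>)\<^sup>2 \<partial>M)
           = 1 / (real N)\<^sup>2 * (\<Sum>k=1..7. coeffC N k *
               (\<Prod>i=1..n. (coeffb N k * b i + coeffc N k * c i + coeffd N k * dd i) / real N ^ 4))"
proof -
  interpret prob_space M by fact
  let ?I = "{1..n}" and ?L = "{1..N}"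
  let ?S = "\<lambda>i. Rd (d i)" and ?Z = "\<lambda>i k. [X i, X' i, X'' i] ! k"
  let ?\<phi> = "\<lambda>i x y. \<psi> i (vdiff (d i) x y)"
  define A where "A i j k \<omega> = double_centered N (\<lambda>p q. ?\<phi> i (XS p \<omega> i) (XS q \<omega> i)) j k" for i j k \<omega>
  have N: "real N > 0" using \<open>N \<ge> 1\<close> by simp
  have adm: "admissible (d i) (\<rho> i)" if "i \<in> ?I" for i
    using assms(10)[OF that] by (rule admissible.intro)
  have XS: "indep_vars (\<lambda>_. PiM ?I ?S) XS ?L"
    and XS_law: "\<And>l. l \<in> ?L \<Longrightarrow> distr M (PiM ?I ?S) (XS l) = distr M (PiM ?I ?S) (\<lambda>\<omega>. \<lambda>i\<in>?I. X i \<omega>)"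
    using assms(14) by (auto simp: indep_copies_def)
  note comp = indep_vars_components[OF XS assms(11) _ _ _ _ XS_law]
  have V: "indep_vars (\<lambda>p. ?S (snd p)) (\<lambda>p \<omega>. XS (fst p) \<omega> (snd p)) (?L \<times> ?I)"
    using \<open>n \<ge> 1\<close> \<open>N \<ge> 1\<close> by (intro comp) auto
  have measurable_kernel: "(\<lambda>(x, y). ?\<phi> i x y) \<in> borel_measurable (?S i \<Otimes>\<^sub>M ?S i)" if i: "i \<in> ?I" for i
    using measurable_compose[OF measurable_vdiff admissible.measurable_psi[OF adm[OF i]]]
    by (simp add: \<psi>_def case_prod_unfold)

  have K: "iid_kernel M (?S i) (\<lambda>l \<omega>. XS l \<omega> i) (?Z i) N (distr M (?S i) (X i)) (?\<phi> i) (\<psi> i)"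
    if i: "i \<in> ?I" for i
  proof
    interpret admissible "d i" "\<rho> i" by (rule adm[OF i])
    show "indep_vars (\<lambda>_. ?S i) (\<lambda>l \<omega>. XS l \<omega> i) ?L"
      using XS measurable_component_singleton[OF i] by (rule indep_vars_compose2)
    show "distr M (?S i) (\<lambda>\<omega>. XS l \<omega> i) = distr M (?S i) (X i)" if "l \<in> ?L" for l
      using that i by (intro comp(2)) auto
    show "indep_vars (\<lambda>_. ?S i) (?Z i) {0, 1, 2}"
      and "\<And>k. k \<in> {0, 1, 2} \<Longrightarrow> distr M (?S i) (?Z i k) = distr M (?S i) (X i)"
      using assms(13)[OF i] by (auto simp: indep_copies_def)
    show "(\<lambda>(x, y). ?\<phi> i x y) \<in> borel_measurable (?S i \<Otimes>\<^sub>M ?S i)" by (rule measurable_kernel[OF i])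
    show "?\<phi> i x x = 0" for x by (simp add: \<psi>_def psi_vdiff_self)
    show "?\<phi> i x y = ?\<phi> i y x" for x y unfolding \<psi>_def by (rule psi_vdiff_commute)
    show "\<psi> i \<in> borel_measurable (?S i)" unfolding \<psi>_def by (rule measurable_psi)
    show "\<bar>?\<phi> i x y\<bar> \<le> 2 * \<psi> i x + 2 * \<psi> i y" for x y
      using psi_vdiff_le psi_nonneg by (simp add: \<psi>_def)
    show "integrable M (\<lambda>\<omega>. (\<psi> i (?Z i 0 \<omega>))\<^sup>2)" using assms(12)[OF i] by simp
  qed
  have A_eq: "A i j k = iid_kernel.centered_kernel (\<lambda>l \<omega>. XS l \<omega> i) N (?\<phi> i) j k" if "i \<in> ?I" for i j k
    by (simp add: fun_eq_iff A_def iid_kernel.centered_kernel_def[OF K[OF that]])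
  have \<mu>_eq: "iid_kernel.\<mu> M (?Z i) (?\<phi> i) = \<mu> i" if "i \<in> ?I" for i
    by (simp add: iid_kernel.\<mu>_def[OF K[OF that]] \<mu>_def)
  have \<beta>_eq: "iid_kernel.\<beta> M (?Z i) (?\<phi> i) = b i" if "i \<in> ?I" for i
    by (simp add: iid_kernel.\<beta>_def[OF K[OF that]] b_def)
  have \<gamma>_eq: "iid_kernel.\<gamma> M (?Z i) (?\<phi> i) = c i" if "i \<in> ?I" for i
    by (simp add: iid_kernel.\<gamma>_def[OF K[OF that]] c_def)
  have dd_eq: "dd i = (\<mu> i)\<^sup>2" for i by (simp add: dd_def \<mu>_def)

  have measurable_double_centered: "(\<lambda>x. double_centered N (\<lambda>p q. ?\<phi> i (x (p, i)) (x (q, i))) j k)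
      \<in> borel_measurable (PiM (?L \<times> {i}) (\<lambda>p. ?S (snd p)))" if i: "i \<in> ?I" for i j k
  proof -
    have "(\<lambda>x. ?\<phi> i (x (p, i)) (x (q, i))) \<in> borel_measurable (PiM (?L \<times> {i}) (\<lambda>p. ?S (snd p)))"
      if "p \<in> ?L" "q \<in> ?L" for p q
    proof -
      have "(\<lambda>x. x (u, i)) \<in> PiM (?L \<times> {i}) (\<lambda>p. ?S (snd p)) \<rightarrow>\<^sub>M ?S i" if "u \<in> ?L" for u
        using that measurable_component_singleton[of "(u, i)" "?L \<times> {i}" "\<lambda>p. ?S (snd p)"] by simp
      from measurable_compose[OF measurable_Pair[OF this[OF that(1)] this[OF that(2)]] measurable_kernel[OF i]]
      show ?thesis by simp
    qed
    then show ?thesis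
      unfolding double_centered_def
      by (intro borel_measurable_uminus borel_measurable_sum borel_measurable_times borel_measurable_const) auto
  qed
  \<comment> \<open>The components \<open>XS l i\<close> are grouped by \<open>i\<close>, and
    \<open>A i j k\<close> is a function of block \<open>i\<close> alone. The general
    \<open>F\<close> covers both a single entry, needed for the first moment, and a product of two
    entries, needed for the second.\<close>
  have indep: "indep_vars (\<lambda>_. borel) (\<lambda>i \<omega>. F i (A i j k \<omega>) (A i l m \<omega>)) ?I"
    if F: "\<And>i. (\<lambda>(x, y). F i x y) \<in> borel_measurable (borel \<Otimes>\<^sub>M borel)"
    for F :: "nat \<Rightarrow> real \<Rightarrow> real \<Rightarrow> real" and j k l m
  proof -
    let ?D = "\<lambda>i j k x. double_centered N (\<lambda>p q. ?\<phi> i (x (p, i)) (x (q, i))) j k"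
    have "indep_vars (\<lambda>i. PiM (?L \<times> {i}) (\<lambda>p. ?S (snd p)))
        (\<lambda>i \<omega>. restrict (\<lambda>p. XS (fst p) \<omega> (snd p)) (?L \<times> {i})) ?I"
      by (rule indep_vars_restrict[OF V]) (auto simp: disjoint_family_on_def)
    then have "indep_vars (\<lambda>_. borel)
        (\<lambda>i \<omega>. (\<lambda>x. F i (?D i j k x) (?D i l m x)) (restrict (\<lambda>p. XS (fst p) \<omega> (snd p)) (?L \<times> {i}))) ?I"
    proof (rule indep_vars_compose2)
      fix i assume "i \<in> ?I"
      from measurable_compose[OF measurable_Pair[OF measurable_double_centered[OF this] measurable_double_centered[OF this]] F]
      show "(\<lambda>x. F i (?D i j k x) (?D i l m x)) \<in> borel_measurable (PiM (?L \<times> {i}) (\<lambda>p. ?S (snd p)))"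
        by simp
    qed
    moreover have "?D i j k (restrict (\<lambda>p. XS (fst p) \<omega> (snd p)) (?L \<times> {i})) = A i j k \<omega>" for i j k \<omega>
      unfolding A_def double_centered_def by (intro arg_cong[where f = uminus] sum.cong refl) simp
    ultimately show ?thesis by simp
  qed

  have T: "T \<omega> = 1 / real N * (\<Sum>j=1..N. \<Sum>k=1..N. \<Prod>i=1..n. A i j k \<omega>)" for \<omega>
  proof -
    have "(sample_multivariance n d \<rho> N (\<lambda>l. XS l \<omega>))\<^sup>2
        = 1 / (real N)\<^sup>2 * (\<Sum>j=1..N. \<Sum>k=1..N. \<Prod>i=1..n. A i j k \<omega>)"
      unfolding A_def \<psi>_def by (rule sample_multivariance_square) (rule assms(10))
    then show ?thesis using N by (simp add: T_def power2_eq_square)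
  qed

  have "has_bochner_integral M (\<lambda>\<omega>. \<Prod>i=1..n. A i j k \<omega>) (\<Prod>i=1..n. \<mu> i * centering N j k)"
    if jk: "j \<in> ?L" "k \<in> ?L" for j k
  proof -
    have ind: "indep_vars (\<lambda>_. borel) (\<lambda>i. A i j k) ?I"
      using indep[of "\<lambda>i x y. x" j k j k] by simp
    have int: "integrable M (A i j k)" if "i \<in> ?I" for i
      using iid_kernel.integrable_centered_kernel[OF K[OF that]] A_eq[OF that] by simp
    have "expectation (\<lambda>\<omega>. \<Prod>i=1..n. A i j k \<omega>) = (\<Prod>i=1..n. expectation (A i j k))"
      by (intro indep_vars_lebesgue_integral ind int) auto
    also have "\<dots> = (\<Prod>i=1..n. \<mu> i * centering N j k)"
      using iid_kernel.expectation_centered_kernel[OF K jk] by (intro prod.cong refl) (simp add: A_eq \<mu>_eq)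
    finally show ?thesis
      using indep_vars_integrable[OF _ ind int] by (simp add: has_bochner_integral_iff)
  qed
  then have "has_bochner_integral M T (1 / real N * (\<Sum>j=1..N. \<Sum>k=1..N. \<Prod>i=1..n. \<mu> i * centering N j k))"
    unfolding T[abs_def] by (intro has_bochner_integral_mult_right has_bochner_integral_sum)
  moreover have "1 / real N * (\<Sum>j=1..N. \<Sum>k=1..N. \<Prod>i=1..n. \<mu> i * centering N j k)
      = (\<Prod>i=1..n. \<mu> i) * ((1 - 1 / real N) ^ n + (real N - 1) * (- 1 / real N) ^ n)"
    using N sum_power_centering[OF \<open>N \<ge> 1\<close>, of n]
    by (simp add: prod.distrib flip: sum_distrib_left)
  ultimately have ET: "has_bochner_integral M T
      ((\<Prod>i=1..n. \<mu> i) * ((1 - 1 / real N) ^ n + (real N - 1) * (- 1 / real N) ^ n))" by simp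

  \<comment> \<open>The two entries that belong to the same \<open>i\<close> are dependent. They are
    paired into one factor, so that independence over \<open>i\<close> still moves the expectation
    inside the product.\<close>
  have "has_bochner_integral M (\<lambda>\<omega>. (\<Prod>i=1..n. A i j k \<omega>) * (\<Prod>i=1..n. A i l m \<omega>))
      (\<Prod>i=1..n. moment2 N (b i) (c i) (dd i) j k l m)"
    if jk: "j \<in> ?L" "k \<in> ?L" "l \<in> ?L" "m \<in> ?L" for j k l m
  proof -
    have ind: "indep_vars (\<lambda>_. borel) (\<lambda>i \<omega>. A i j k \<omega> * A i l m \<omega>) ?I"
      by (rule indep) measurable
    have int: "integrable M (\<lambda>\<omega>. A i j k \<omega> * A i l m \<omega>)" if "i \<in> ?I" for i
      using iid_kernel.integrable_centered_kernel_mult[OF K[OF that]] A_eq[OF that] by simp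
    have "expectation (\<lambda>\<omega>. \<Prod>i=1..n. A i j k \<omega> * A i l m \<omega>)
        = (\<Prod>i=1..n. expectation (\<lambda>\<omega>. A i j k \<omega> * A i l m \<omega>))"
      by (intro indep_vars_lebesgue_integral ind int) auto
    also have "\<dots> = (\<Prod>i=1..n. moment2 N (b i) (c i) (dd i) j k l m)"
      using iid_kernel.expectation_centered_kernel_mult[OF K jk]
      by (intro prod.cong refl) (simp add: A_eq \<mu>_eq \<beta>_eq \<gamma>_eq dd_eq)
    finally show ?thesis
      using indep_vars_integrable[OF _ ind int] by (simp add: has_bochner_integral_iff prod.distrib)
  qed
  then have "has_bochner_integral M (\<lambda>\<omega>. 1 / (real N)\<^sup>2 * (\<Sum>j=1..N. \<Sum>k=1..N. \<Sum>l=1..N. \<Sum>m=1..N.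
        (\<Prod>i=1..n. A i j k \<omega>) * (\<Prod>i=1..n. A i l m \<omega>)))
      (1 / (real N)\<^sup>2 * (\<Sum>j=1..N. \<Sum>k=1..N. \<Sum>l=1..N. \<Sum>m=1..N.
        \<Prod>i=1..n. moment2 N (b i) (c i) (dd i) j k l m))"
    by (intro has_bochner_integral_mult_right has_bochner_integral_sum)
  moreover have "(\<lambda>\<omega>. 1 / (real N)\<^sup>2 * (\<Sum>j=1..N. \<Sum>k=1..N. \<Sum>l=1..N. \<Sum>m=1..N.
        (\<Prod>i=1..n. A i j k \<omega>) * (\<Prod>i=1..n. A i l m \<omega>))) = (\<lambda>\<omega>. (T \<omega>)\<^sup>2)"
    unfolding T sum2_mult_sum2[symmetric] by (simp add: power2_eq_square)
  \<comment> \<open>For every \<open>i\<close> the factor depends on the quadruple only through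
    \<open>pattern_class\<close>, and so does the product. The fourfold sum therefore collapses to
    seven weighted terms.\<close>
  moreover have "(\<Sum>j=1..N. \<Sum>k=1..N. \<Sum>l=1..N. \<Sum>m=1..N. \<Prod>i=1..n. moment2 N (b i) (c i) (dd i) j k l m)
      = (\<Sum>k=1..7. coeffC N k *
               (\<Prod>i=1..n. (coeffb N k * b i + coeffc N k * c i + coeffd N k * dd i) / real N ^ 4))"
    unfolding sum_pattern_class[symmetric]
    by (intro sum.cong prod.cong refl moment2_eq_coeff)
  ultimately have ET2: "has_bochner_integral M (\<lambda>\<omega>. (T \<omega>)\<^sup>2) (1 / (real N)\<^sup>2 * (\<Sum>k=1..7. coeffC N k *
      (\<Prod>i=1..n. (coeffb N k * b i + coeffc N k * c i + coeffd N k * dd i) / real N ^ 4)))" by simp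

  have coeff: "((real N - 1) ^ n + (- 1) ^ n * (real N - 1)) / real N ^ n
      = (1 - 1 / real N) ^ n + (real N - 1) * (- 1 / real N) ^ n"
  proof -
    have "1 - 1 / real N = (real N - 1) / real N" using N by (simp add: diff_divide_distrib)
    then show ?thesis unfolding power_divide by (simp add: add_divide_distrib power_divide)
  qed
  have "(\<Prod>i=1..n. (1 - 1 / real N) * \<mu> i) + (real N - 1) * (\<Prod>i=1..n. (- 1 / real N) * \<mu> i)
      = ((1 - 1 / real N) ^ n + (real N - 1) * (- 1 / real N) ^ n) * (\<Prod>i=1..n. \<mu> i)"
    by (simp only: prod.distrib prod_constant card_atLeastAtMost) (simp add: distrib_right)
  with ET ET2 show ?thesis
    unfolding coeff by (simp add: has_bochner_integral_iff mult.commute)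
qed

end
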